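(* Let $n,d,r$ be positive integers. There exists an open and dense semi-algebraic set $\mathcal{U}_3$ in $\mathbb{R}^{r\times n(d)}$ such that for any $u\in\mathcal{U}_3$, the set $\mathrm{Crit}(\mathcal{C}(F(x,u)))$ is finite and its number of points is bounded from above by $$B_0(n,d,r):=(d+1)(2d+1)^{n+r-1}+\sum_{s=1}^{r-1}\binom{r}{s}\left[(r-s)(d+1)+1\right]\left[2(r-s)(d+1)+1\right]^{n+s}.$$ Moreover, for any $u\in\mathcal{U}_3$, any $f\in\mathcal{C}(F(x,u))$ and any critical point $x^0$ of $f$: (i) strict complementarity holds for $x^0$; (ii) for $(\mu_i)_{i\in I(f,x^0)}$ a multiplier tuple of $f$ at $x^0$, the system $\left(\sum_{i\in I(f,x^0)}\mu_i \nabla_x^2 f_i(x^0,u^{(i)})\right)y=0$ does not have a nonzero solution $y$ in the set $\{y\in\mathbb{R}^n : \nabla_x f_i(x^0, u^{(i)})^Ty=0,\ i\in I(f,x^0)\}$.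
   Context: Let $n(d):=\#\{\alpha\in\mathbb{N}^n : |\alpha|\le d\}$, where $|\alpha|=\alpha_1+\cdots+\alpha_n$. For $u=(u^{(1)},\ldots,u^{(r)})\in\mathbb{R}^{r\times n(d)}$ with $u^{(i)}=(u^{(i)}_\alpha)_{|\alpha|\le d}\in\mathbb{R}^{n(d)}$, put $f_i(x,u^{(i)})=\sum_{|\alpha|\le d}u^{(i)}_\alpha x^\alpha$, a polynomial in $x\in\mathbb{R}^n$ of degree at most $d$, and $F(x,u)=(f_1(x,u^{(1)}),\ldots,f_r(x,u^{(r)}))$. $\nabla_x$ and $\nabla_x^2$ denote gradient and Hessian in $x$. $\mathcal{C}(F(x,u))$ is the set of all continuous selections of these polynomials, i.e. all continuous functions $f\colon\mathbb{R}^n\to\mathbb{R}$ with $f(x)\in\{f_1(x,u^{(1)}),\ldots,f_r(x,u^{(r)})\}$ for every $x\in\mathbb{R}^n$; such functions are locally Lipschitz. The active index set is $I(f,x)=\{i : f_i(x,u^{(i)})=f(x)\}$. For a locally Lipschitz $f$, $f^0(\bar x;v)=\limsup_{x\to\bar x,\,t\downarrow0}\frac{f(x+tv)-f(x)}{t}$ and the Clarke subdifferential is $\partial^\circ f(\bar x)=\{\zeta\in\mathbb{R}^n : \langle\zeta,v\rangle\le f^0(\bar x;v)\ \forall v\in\mathbb{R}^n\}$. A point $x^0$ is a critical point of $f$ if $0\in\partial^\circ f(x^0)$. $\mathrm{Crit}(\mathcal{C}(F(x,u)))$ is the set of all points that are critical for at least one $f\in\mathcal{C}(F(x,u))$. A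 multiplier tuple of $f$ at $x^0$ is a tuple $(\mu_i)_{i\in I(f,x^0)}$ of reals with $\mu_i\ge0$, $\sum_{i\in I(f,x^0)}\mu_i=1$ and $\sum_{i\in I(f,x^0)}\mu_i\nabla_x f_i(x^0,u^{(i)})=0$. Strict complementarity holds for the critical point $x^0$ of $f$ if every multiplier tuple of $f$ at $x^0$ has all $\mu_i>0$, $i\in I(f,x^0)$. *)

theory Defs
  imports "HOL-Analysis.Analysis"
begin

text \<open>For a finite index set \<open>J\<close>, the space of real tuples indexed by \<open>J\<close> is the carrier
  \<open>J \<rightarrow>\<^sub>E UNIV\<close> of \<open>powertop_real J\<close>.\<close>

inductive_set poly_funs :: "'j set \<Rightarrow> (('j \<Rightarrow> real) \<Rightarrow> real) set" for J :: "'j set" where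
  const: "(\<lambda>x. c) \<in> poly_funs J"
| coord: "j \<in> J \<Longrightarrow> (\<lambda>x. x j) \<in> poly_funs J"
| add: "p \<in> poly_funs J \<Longrightarrow> q \<in> poly_funs J \<Longrightarrow> (\<lambda>x. p x + q x) \<in> poly_funs J"
| mult: "p \<in> poly_funs J \<Longrightarrow> q \<in> poly_funs J \<Longrightarrow> (\<lambda>x. p x * q x) \<in> poly_funs J"

text \<open>The smallest family containing all sets given by one strict polynomial inequality and
  closed under the Boolean operations. Polynomial equations are covered, since \<open>p x = 0\<close> means
  that neither \<open>p x > 0\<close> nor \<open>- p x > 0\<close>.\<close>

inductive_set semialgebraic :: "'j set \<Rightarrow> ('j \<Rightarrow> real) set set" for J :: "'j set" where
  pos: "p \<in> poly_funs J \<Longrightarrow> {x \<in> J \<rightarrow>\<^sub>E UNIV. p x > 0} \<in> semialgebraic J"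
| compl: "A \<in> semialgebraic J \<Longrightarrow> (J \<rightarrow>\<^sub>E UNIV) - A \<in> semialgebraic J"
| un: "A \<in> semialgebraic J \<Longrightarrow> B \<in> semialgebraic J \<Longrightarrow> A \<union> B \<in> semialgebraic J"
| inter: "A \<in> semialgebraic J \<Longrightarrow> B \<in> semialgebraic J \<Longrightarrow> A \<inter> B \<in> semialgebraic J"

definition gradient :: "('a::real_inner \<Rightarrow> real) \<Rightarrow> 'a \<Rightarrow> 'a" where
  "gradient f x = (THE D. GDERIV f x :> D)"

definition hessian :: "(real^'n \<Rightarrow> real) \<Rightarrow> real^'n \<Rightarrow> real^'n^'n" where
  "hessian f x = jacobian (gradient f) (at x)"

text \<open>The upper limit is taken in the extended reals; it is finite for locally Lipschitz \<open>f\<close>.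
  As usual for Clarke's derivative, the base point \<open>y\<close> may be equal to \<open>x\<close>, hence \<open>nhds\<close>.\<close>

definition clarke_deriv :: "('a::real_inner \<Rightarrow> real) \<Rightarrow> 'a \<Rightarrow> 'a \<Rightarrow> ereal" where
  "clarke_deriv f x v =
     Limsup (nhds x \<times>\<^sub>F at_right (0::real)) (\<lambda>(y, t). ereal ((f (y + t *\<^sub>R v) - f y) / t))"

definition clarke_subdiff :: "('a::real_inner \<Rightarrow> real) \<Rightarrow> 'a \<Rightarrow> 'a set" where
  "clarke_subdiff f x = {\<zeta>. \<forall>v. ereal (\<zeta> \<bullet> v) \<le> clarke_deriv f x v}"

definition critical_point :: "('a::real_inner \<Rightarrow> real) \<Rightarrow> 'a \<Rightarrow> bool" where
  "critical_point f x \<longleftrightarrow> 0 \<in> clarke_subdiff f x"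

definition multi_indices :: "nat \<Rightarrow> ('n::finite \<Rightarrow> nat) set" where
  "multi_indices d = {\<alpha>. (\<Sum>j\<in>UNIV. \<alpha> j) \<le> d}"

text \<open>A parameter \<open>u\<close> is indexed by pairs \<open>(i, \<alpha>)\<close> with \<open>1 \<le> i \<le> r\<close> and \<open>\<bar>\<alpha>\<bar> \<le> d\<close>.\<close>

definition param_indices :: "nat \<Rightarrow> nat \<Rightarrow> (nat \<times> ('n::finite \<Rightarrow> nat)) set" where
  "param_indices d r = {1..r} \<times> multi_indices d"

definition poly_fun ::
  "nat \<Rightarrow> (nat \<times> ('n::finite \<Rightarrow> nat) \<Rightarrow> real) \<Rightarrow> nat \<Rightarrow> real^'n \<Rightarrow> real" where
  "poly_fun d u i x = (\<Sum>\<alpha>\<in>multi_indices d. u (i, \<alpha>) * (\<Prod>j\<in>UNIV. (x $ j) ^ \<alpha> j))"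

definition cont_selections ::
  "nat \<Rightarrow> nat \<Rightarrow> (nat \<times> ('n::finite \<Rightarrow> nat) \<Rightarrow> real) \<Rightarrow> (real^'n \<Rightarrow> real) set" where
  "cont_selections d r u =
     {f. continuous_on UNIV f \<and> (\<forall>x. f x \<in> (\<lambda>i. poly_fun d u i x) ` {1..r})}"

definition active ::
  "nat \<Rightarrow> nat \<Rightarrow> (nat \<times> ('n::finite \<Rightarrow> nat) \<Rightarrow> real) \<Rightarrow> (real^'n \<Rightarrow> real) \<Rightarrow> real^'n \<Rightarrow> nat set" where
  "active d r u f x = {i \<in> {1..r}. poly_fun d u i x = f x}"

definition Crit ::
  "nat \<Rightarrow> nat \<Rightarrow> (nat \<times> ('n::finite \<Rightarrow> nat) \<Rightarrow> real) \<Rightarrow> (real^'n) set" where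
  "Crit d r u = {x. \<exists>f \<in> cont_selections d r u. critical_point f x}"

text \<open>Only the values of \<open>\<mu>\<close> on the active index set matter.\<close>

definition multiplier ::
  "nat \<Rightarrow> nat \<Rightarrow> (nat \<times> ('n::finite \<Rightarrow> nat) \<Rightarrow> real) \<Rightarrow> (real^'n \<Rightarrow> real) \<Rightarrow> real^'n
     \<Rightarrow> (nat \<Rightarrow> real) \<Rightarrow> bool" where
  "multiplier d r u f x \<mu> \<longleftrightarrow>
     (\<forall>i \<in> active d r u f x. \<mu> i \<ge> 0) \<and>
     (\<Sum>i \<in> active d r u f x. \<mu> i) = 1 \<and>
     (\<Sum>i \<in> active d r u f x. \<mu> i *\<^sub>R gradient (poly_fun d u i) x) = 0"

definition strict_complementarity ::
  "nat \<Rightarrow> nat \<Rightarrow> (nat \<times> ('n::finite \<Rightarrow> nat) \<Rightarrow> real) \<Rightarrow> (real^'n \<Rightarrow> real) \<Rightarrow> real^'n \<Rightarrow> bool" where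
  "strict_complementarity d r u f x \<longleftrightarrow>
     (\<forall>\<mu>. multiplier d r u f x \<mu> \<longrightarrow> (\<forall>i \<in> active d r u f x. \<mu> i > 0))"

definition B\<^sub>0 :: "nat \<Rightarrow> nat \<Rightarrow> nat \<Rightarrow> nat" where
  "B\<^sub>0 n d r = (d + 1) * (2 * d + 1) ^ (n + r - 1) +
     (\<Sum>s = 1..r - 1. (r choose s) * ((r - s) * (d + 1) + 1) * (2 * (r - s) * (d + 1) + 1) ^ (n + s))"

end

theory Submission
  imports Defs "HOL-Computational_Algebra.Polynomial"
begin

text \<open>A critical point \<open>x\<close> of a selection has a multiplier tuple. Dividing by a positive entry \<open>\<mu>\<^bsub>i0\<^esub>\<close>
  turns \<open>x\<close> into a solution of a square system in \<open>x\<close> and \<open>(\<mu>\<^sub>i)\<close>, \<open>i \<in> I - {i0}\<close>, where \<open>I\<close> is the active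
  index set: \<open>f\<^sub>i(x) = f\<^bsub>i0\<^esub>(x)\<close> and \<open>\<nabla>f\<^bsub>i0\<^esub>(x) + \<Sum>\<^sub>i \<mu>\<^sub>i \<nabla>f\<^sub>i(x) = 0\<close>. The system can be solved for as many
  coefficients of the \<open>f\<^sub>i\<close> as there are unknowns, so its solution set is the graph of a polynomial
  map \<open>\<phi>\<close> from a space of the same dimension as the parameter space. Degenerate solutions are
  critical points of \<open>\<phi>\<close>, and solutions with some \<open>\<mu>\<^sub>i = 0\<close> lie on a hyperplane. Counting monomials
  gives algebraic relations which show that the images of both sets under \<open>\<phi>\<close> lie in \<open>{P = 0}\<close> for a
  nonzero polynomial \<open>P\<close>, and the open dense set is \<open>{P \<noteq> 0}\<close>.

  For the bound, nondegenerate zeros survive when \<open>\<epsilon> z\<^sub>j\<^bsup>d+1\<^esup>\<close> is added to the \<open>j\<close>-th equation, which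
  has degree at most \<open>d\<close>. Modulo the perturbed equations every polynomial reduces to exponents at
  most \<open>d\<close>, so the system for \<open>I\<close> has at most \<open>(d + 1)\<^bsup>n + |I| - 1\<^esup>\<close> solutions. Summing over \<open>I\<close> gives
  less than \<open>(d + 1)\<^bsup>n - 1\<^esup> (d + 2)\<^sup>r\<close>, which is at most the first term of \<open>B\<^sub>0\<close>.\<close>

section \<open>Polynomial functions and algebraic relations\<close>

text \<open>Gaussian elimination by induction on the equations; \<alpha> indexes unknowns and
  \<beta> equations. It supplies the algebraic relations, the bound on the number of zeros and the
  dependency among too many gradients.\<close>

lemma underdetermined_system:
  fixes c :: "'a \<Rightarrow> 'b \<Rightarrow> real"
  assumes "finite B" "finite A" "card B < card A"
  shows "\<exists>a. (\<exists>\<alpha>\<in>A. a \<alpha> \<noteq> 0) \<and> (\<forall>\<beta>\<in>B. (\<Sum>\<alpha>\<in>A. a \<alpha> * c \<alpha> \<beta>) = 0)"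
  using assms
proof (induction B arbitrary: A c rule: finite_induct)
  case empty
  then obtain \<alpha> where "\<alpha> \<in> A" by (metis card.empty card_gt_0_iff ex_in_conv)
  then show ?case by (intro exI[of _ "\<lambda>_. 1"]) auto
next
  case (insert b B)
  show ?case
  proof (cases "\<forall>\<alpha>\<in>A. c \<alpha> b = 0")
    case True
    have "card B < card A" using insert.hyps insert.prems by simp
    from insert.IH[OF insert.prems(1) this, of c] obtain a where
      "\<exists>\<alpha>\<in>A. a \<alpha> \<noteq> 0" "\<forall>\<beta>\<in>B. (\<Sum>\<alpha>\<in>A. a \<alpha> * c \<alpha> \<beta>) = 0" by blast
    with True show ?thesis by (intro exI[of _ a]) simp
  next
    case False
    then obtain o' where o: "o' \<in> A" "c o' b \<noteq> 0" by blast
    let ?A = "A - {o'}"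
    \<comment> \<open>The remaining equations after \<open>o'\<close> has been eliminated with the
      help of equation \<open>b\<close>.\<close>
    define c' where "c' = (\<lambda>\<alpha> \<beta>. c \<alpha> \<beta> - c \<alpha> b / c o' b * c o' \<beta>)"
    have "card B < card ?A" using insert.hyps insert.prems o by simp
    moreover have "finite ?A" using insert.prems by simp
    ultimately obtain a where
      a: "\<exists>\<alpha>\<in>?A. a \<alpha> \<noteq> 0" "\<And>\<beta>. \<beta> \<in> B \<Longrightarrow> (\<Sum>\<alpha>\<in>?A. a \<alpha> * c' \<alpha> \<beta>) = 0"
      using insert.IH[of ?A c'] by blast
    \<comment> \<open>Equation \<open>b\<close> then determines the unknown \<open>o'\<close> as
      \<open>- s\<close>.\<close>
    define s where "s = (\<Sum>\<alpha>\<in>?A. a \<alpha> * c \<alpha> b) / c o' b"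
    define a' where "a' = a(o' := - s)"
    have split: "(\<Sum>\<alpha>\<in>A. a' \<alpha> * c \<alpha> \<beta>) = (\<Sum>\<alpha>\<in>?A. a \<alpha> * c \<alpha> \<beta>) - s * c o' \<beta>" for \<beta>
    proof -
      have "(\<Sum>\<alpha>\<in>A. a' \<alpha> * c \<alpha> \<beta>) = a' o' * c o' \<beta> + (\<Sum>\<alpha>\<in>?A. a' \<alpha> * c \<alpha> \<beta>)"
        using o insert.prems by (simp add: sum.remove)
      also have "(\<Sum>\<alpha>\<in>?A. a' \<alpha> * c \<alpha> \<beta>) = (\<Sum>\<alpha>\<in>?A. a \<alpha> * c \<alpha> \<beta>)"
        by (rule sum.cong) (auto simp: a'_def)
      finally show ?thesis by (simp add: a'_def)
    qed
    have eq: "(\<Sum>\<alpha>\<in>?A. a \<alpha> * c' \<alpha> \<beta>) = (\<Sum>\<alpha>\<in>?A. a \<alpha> * c \<alpha> \<beta>) - s * c o' \<beta>" for \<beta>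
      by (simp add: c'_def s_def right_diff_distrib sum_subtractf sum_distrib_right
          sum_divide_distrib mult.assoc)
    have "(\<Sum>\<alpha>\<in>A. a' \<alpha> * c \<alpha> \<beta>) = 0" if "\<beta> \<in> insert b B" for \<beta>
      using that a(2)[of \<beta>] eq[of \<beta>] split[of \<beta>] o(2) by (auto simp: s_def)
    moreover have "\<exists>\<alpha>\<in>A. a' \<alpha> \<noteq> 0" using a(1) by (auto simp: a'_def)
    ultimately show ?thesis by blast
  qed
qed

text \<open>\<open>e\<close> is an upper bound for the total degree. The only product rule
  multiplies by a single coordinate, so inductions over \<open>pdeg\<close> move one variable at a
  time; general products follow in \<open>pdeg_mult\<close>.\<close>

inductive pdeg :: "'j set \<Rightarrow> nat \<Rightarrow> (('j \<Rightarrow> real) \<Rightarrow> real) \<Rightarrow> bool" for J :: "'j set" where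
  const: "pdeg J e (\<lambda>x. c)"
| add: "pdeg J e p \<Longrightarrow> pdeg J e q \<Longrightarrow> pdeg J e (\<lambda>x. p x + q x)"
| shift: "j \<in> J \<Longrightarrow> pdeg J e p \<Longrightarrow> pdeg J (Suc e) (\<lambda>x. x j * p x)"

lemma pdeg_mono: "pdeg J e p \<Longrightarrow> e \<le> e' \<Longrightarrow> pdeg J e' p"
proof (induction arbitrary: e' rule: pdeg.induct)
  case (shift j e p)
  then obtain e'' where "e' = Suc e''" "e \<le> e''" by (metis Suc_le_D Suc_le_mono)
  with shift show ?case by (simp add: pdeg.shift)
qed (simp_all add: pdeg.const pdeg.add)

lemma pdeg_cmult: "pdeg J e p \<Longrightarrow> pdeg J e (\<lambda>x. c * p x)"
proof (induction rule: pdeg.induct)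
  case (shift j e p)
  then have "pdeg J (Suc e) (\<lambda>x. x j * (c * p x))" by (intro pdeg.shift)
  then show ?case by (simp add: mult.left_commute)
qed (simp_all add: distrib_left pdeg.const pdeg.add)

lemma pdeg_mult: "pdeg J a p \<Longrightarrow> pdeg J b q \<Longrightarrow> pdeg J (a + b) (\<lambda>x. p x * q x)"
proof (induction rule: pdeg.induct)
  case (const e c)
  then show ?case by (intro pdeg_cmult) (erule pdeg_mono, simp)
next
  case (shift j e p)
  then have "pdeg J (Suc (e + b)) (\<lambda>x. x j * (p x * q x))" by (intro pdeg.shift) auto
  then show ?case by (simp add: mult.assoc)
qed (simp add: distrib_right pdeg.add)

lemma pdeg_coord: "j \<in> J \<Longrightarrow> pdeg J (Suc e) (\<lambda>x. x j)"
  using pdeg.shift[OF _ pdeg.const[of J e 1]] by simp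

lemma pdeg_uminus: "pdeg J e p \<Longrightarrow> pdeg J e (\<lambda>x. - p x)"
  using pdeg_cmult[of J e p "-1"] by simp

lemma pdeg_diff:
  assumes "pdeg J e p" "pdeg J e q"
  shows "pdeg J e (\<lambda>x. p x - q x)"
  using pdeg.add[OF assms(1) pdeg_uminus[OF assms(2)]] by simp

lemma pdeg_sum: "(\<And>i. i \<in> A \<Longrightarrow> pdeg J e (p i)) \<Longrightarrow> pdeg J e (\<lambda>x. \<Sum>i\<in>A. p i x)"
  by (induction A rule: infinite_finite_induct) (simp_all add: pdeg.intros)

lemma pdeg_power: "pdeg J e p \<Longrightarrow> pdeg J (k * e) (\<lambda>x. p x ^ k)"
proof (induction k)
  case 0
  then show ?case by (simp add: pdeg.const)
next
  case (Suc k)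
  from pdeg_mult[OF Suc.prems Suc.IH[OF Suc.prems]] show ?case by simp
qed

lemma pdeg_prod:
  "(\<And>i. i \<in> A \<Longrightarrow> pdeg J (e i) (p i)) \<Longrightarrow> pdeg J (\<Sum>i\<in>A. e i) (\<lambda>x. \<Prod>i\<in>A. p i x)"
proof (induction A rule: infinite_finite_induct)
  case (insert i A)
  then show ?case by (simp add: pdeg_mult)
qed (simp_all add: pdeg.const)

lemma poly_funs_pdeg: "p \<in> poly_funs J \<Longrightarrow> \<exists>e. pdeg J e p"
proof (induction rule: poly_funs.induct)
  case (add p q)
  then obtain a b where "pdeg J a p" "pdeg J b q" by blast
  then have "pdeg J (max a b) p" "pdeg J (max a b) q"
    by (simp_all add: pdeg_mono)
  then show ?case by (intro exI pdeg.add)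
next
  case (const c)
  show ?case by (intro exI pdeg.const)
next
  case (coord j)
  then show ?case by (intro exI[of _ "Suc 0"] pdeg_coord)
next
  case (mult p q)
  then obtain a b where "pdeg J a p" "pdeg J b q" by blast
  then show ?case by (intro exI[of _ "a + b"] pdeg_mult)
qed

section \<open>Closure and vanishing properties of polynomial functions\<close>

lemma poly_funs_uminus: "p \<in> poly_funs J \<Longrightarrow> (\<lambda>x. - p x) \<in> poly_funs J"
  using poly_funs.mult[OF poly_funs.const[of "-1"], of p J] by simp

lemma poly_funs_diff:
  assumes "p \<in> poly_funs J" "q \<in> poly_funs J"
  shows "(\<lambda>x. p x - q x) \<in> poly_funs J"
  using poly_funs.add[OF assms(1) poly_funs_uminus[OF assms(2)]] by simp

lemma poly_funs_sum:
  "(\<And>i. i \<in> A \<Longrightarrow> p i \<in> poly_funs J) \<Longrightarrow> (\<lambda>x. \<Sum>i\<in>A. p i x) \<in> poly_funs J"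
  by (induction A rule: infinite_finite_induct) (simp_all add: poly_funs.intros)

lemma poly_funs_prod:
  "(\<And>i. i \<in> A \<Longrightarrow> p i \<in> poly_funs J) \<Longrightarrow> (\<lambda>x. \<Prod>i\<in>A. p i x) \<in> poly_funs J"
  by (induction A rule: infinite_finite_induct) (simp_all add: poly_funs.intros)

lemma poly_funs_power: "p \<in> poly_funs J \<Longrightarrow> (\<lambda>x. p x ^ k) \<in> poly_funs J"
  by (induction k) (simp_all add: poly_funs.intros)

lemma poly_funs_compose:
  "p \<in> poly_funs J \<Longrightarrow> (\<And>j. j \<in> J \<Longrightarrow> (\<lambda>w. \<phi> w j) \<in> poly_funs K) \<Longrightarrow> (\<lambda>w. p (\<phi> w)) \<in> poly_funs K"
  by (induction rule: poly_funs.induct) (simp_all add: poly_funs.intros)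

lemma poly_funs_cong: "p \<in> poly_funs J \<Longrightarrow> (\<And>j. j \<in> J \<Longrightarrow> x j = y j) \<Longrightarrow> p x = p y"
  by (induction rule: poly_funs.induct) auto

text \<open>Restriction to a line reduces questions in several variables to univariate ones: first
  the absence of zero divisors, later density through finiteness of roots.\<close>

lemma poly_funs_line:
  "p \<in> poly_funs J \<Longrightarrow> \<exists>q :: real poly. \<forall>t. p (\<lambda>j. a j + t * b j) = poly q t"
proof (induction rule: poly_funs.induct)
  case (const c)
  then show ?case by (intro exI[of _ "[:c:]"]) auto
next
  case (coord j)
  then show ?case by (intro exI[of _ "[:a j, b j:]"]) auto
next
  case (add p q)
  then show ?case by (metis poly_add)
next
  case (mult p q)
  then show ?case by (metis poly_mult)
qed

text \<open>Polynomial functions have no zero divisors. On the line from \<open>a\<close> to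
  \<open>b\<close> the univariate product \<open>P * Q\<close> is zero and \<open>P\<close> does not
  vanish at parameter 0, so \<open>Q\<close> is zero, in particular at parameter 1.\<close>

lemma poly_funs_mult_eq_0:
  assumes "p \<in> poly_funs J" "q \<in> poly_funs J" "\<And>w. p w * q w = 0" "p a \<noteq> 0"
  shows "q b = 0"
proof -
  obtain P Q where P: "\<And>t. p (\<lambda>j. a j + t * (b j - a j)) = poly P t"
    and Q: "\<And>t. q (\<lambda>j. a j + t * (b j - a j)) = poly Q t"
    using poly_funs_line[OF assms(1), of a "\<lambda>j. b j - a j"]
      poly_funs_line[OF assms(2), of a "\<lambda>j. b j - a j"] by blast
  have "poly (P * Q) t = 0" for t
    using assms(3)[of "\<lambda>j. a j + t * (b j - a j)"] unfolding P Q by simp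
  then have "P * Q = 0" using poly_all_0_iff_0 by blast
  moreover have "P \<noteq> 0" using P[of 0] assms(4) by auto
  ultimately show ?thesis using Q[of 1] by simp
qed

lemma poly_funs_prod_nonzero:
  assumes "finite A" "\<And>i. i \<in> A \<Longrightarrow> p i \<in> poly_funs J" "\<And>i. i \<in> A \<Longrightarrow> \<exists>w. p i w \<noteq> 0"
  shows "\<exists>w. (\<Prod>i\<in>A. p i w) \<noteq> 0"
  using assms
proof (induction A rule: finite_induct)
  case (insert i A)
  then obtain a where "p i a \<noteq> 0" by blast
  moreover obtain b where "(\<Prod>i\<in>A. p i b) \<noteq> 0" using insert by blast
  moreover have "(\<lambda>w. \<Prod>i\<in>A. p i w) \<in> poly_funs J" using insert by (intro poly_funs_prod) auto
  ultimately have "\<exists>w. p i w * (\<Prod>i\<in>A. p i w) \<noteq> 0"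
    using poly_funs_mult_eq_0[of "p i" J "\<lambda>w. \<Prod>i\<in>A. p i w" a b] insert by blast
  then show ?case using insert by simp
qed auto

text \<open>The chain rule for stationary inner functions, a form in which the partial derivatives
  of \<open>p\<close> do not appear.\<close>

lemma poly_funs_deriv_0:
  "p \<in> poly_funs J \<Longrightarrow> (\<And>j. j \<in> J \<Longrightarrow> ((\<lambda>t. c t j) has_real_derivative 0) (at a)) \<Longrightarrow>
    ((\<lambda>t. p (c t)) has_real_derivative 0) (at a)"
proof (induction rule: poly_funs.induct)
  case (add p q)
  then show ?case using DERIV_add[of "\<lambda>t. p (c t)" 0 a UNIV "\<lambda>t. q (c t)" 0] by simp
next
  case (mult p q)
  then show ?case using DERIV_mult[of "\<lambda>t. p (c t)" 0 a UNIV "\<lambda>t. q (c t)" 0] by simp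
qed simp_all

section \<open>Monomial expansions and algebraic dependence\<close>

definition monom_fun :: "'j set \<Rightarrow> ('j \<Rightarrow> nat) \<Rightarrow> ('j \<Rightarrow> real) \<Rightarrow> real" where
  "monom_fun J \<alpha> x = (\<Prod>j\<in>J. x j ^ \<alpha> j)"

lemma monom_fun_poly_funs: "monom_fun J \<alpha> \<in> poly_funs J"
  unfolding monom_fun_def[abs_def] by (intro poly_funs_prod poly_funs_power poly_funs.coord)

lemma monom_fun_Suc:
  assumes "finite J" "j \<in> J"
  shows "monom_fun J (\<alpha>(j := Suc (\<alpha> j))) x = x j * monom_fun J \<alpha> x"
proof -
  have "(\<Prod>i\<in>J - {j}. x i ^ (\<alpha>(j := Suc (\<alpha> j))) i) = (\<Prod>i\<in>J - {j}. x i ^ \<alpha> i)"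
    by (rule prod.cong) auto
  then show ?thesis using assms by (simp add: monom_fun_def prod.remove[of J j])
qed

text \<open>Exponents range over a box rather than a simplex, so the number of monomials is the
  plain power \<open>(e + 1) ^ card J\<close>.\<close>

lemma pdeg_expand:
  assumes "pdeg J e p" "finite J"
  shows "\<exists>c. \<forall>x. p x = (\<Sum>\<beta>\<in>PiE J (\<lambda>_. {..e}). c \<beta> * monom_fun J \<beta> x)"
  using assms
proof (induction rule: pdeg.induct)
  case (const e c)
  let ?z = "restrict (\<lambda>_. 0) J"
  have "(\<Sum>\<beta>\<in>PiE J (\<lambda>_. {..e}). (if \<beta> = ?z then c else 0) * monom_fun J \<beta> x) = c" for x
  proof -
    have "(\<Sum>\<beta>\<in>PiE J (\<lambda>_. {..e}). (if \<beta> = ?z then c else 0) * monom_fun J \<beta> x)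
      = (\<Sum>\<beta>\<in>PiE J (\<lambda>_. {..e}). if \<beta> = ?z then c * monom_fun J ?z x else 0)"
      by (rule sum.cong) auto
    also have "\<dots> = c * monom_fun J ?z x"
      using const by (subst sum.delta) (auto intro: finite_PiE)
    finally show ?thesis by (simp add: monom_fun_def)
  qed
  then show ?case by metis
next
  case (add e p q)
  then obtain c c' where "\<And>x. p x = (\<Sum>\<beta>\<in>PiE J (\<lambda>_. {..e}). c \<beta> * monom_fun J \<beta> x)"
    "\<And>x. q x = (\<Sum>\<beta>\<in>PiE J (\<lambda>_. {..e}). c' \<beta> * monom_fun J \<beta> x)" by blast
  then show ?case
    by (intro exI[of _ "\<lambda>\<beta>. c \<beta> + c' \<beta>"]) (simp add: distrib_right sum.distrib)
next
  case (shift j e p)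
  then obtain c where c: "\<And>x. p x = (\<Sum>\<beta>\<in>PiE J (\<lambda>_. {..e}). c \<beta> * monom_fun J \<beta> x)" by blast
  let ?S = "PiE J (\<lambda>_. {..e})" and ?T = "PiE J (\<lambda>_. {..Suc e})"
  let ?g = "\<lambda>\<beta>. \<beta>(j := Suc (\<beta> j))"
  have g: "?g ` ?S \<subseteq> ?T" using shift(1)
    by (auto simp: PiE_iff extensional_def) (meson le_SucI)
  have fin: "finite ?S" "finite ?T" using shift by (auto intro: finite_PiE)
  \<comment> \<open>Coefficients are collected over the fibres of \<open>?g\<close>; an exponent
    outside its image gets the empty sum 0.\<close>
  have "x j * p x = (\<Sum>\<gamma>\<in>?T. (\<Sum>\<beta>\<in>{\<beta> \<in> ?S. ?g \<beta> = \<gamma>}. c \<beta>) * monom_fun J \<gamma> x)" for x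
  proof -
    have "x j * p x = (\<Sum>\<beta>\<in>?S. c \<beta> * monom_fun J (?g \<beta>) x)"
      unfolding c sum_distrib_left using shift
      by (intro sum.cong) (auto simp: monom_fun_Suc)
    also have "\<dots> = (\<Sum>\<gamma>\<in>?T. \<Sum>\<beta>\<in>{\<beta> \<in> ?S. ?g \<beta> = \<gamma>}. c \<beta> * monom_fun J (?g \<beta>) x)"
      by (rule sum.group[OF fin g, symmetric])
    also have "\<dots> = (\<Sum>\<gamma>\<in>?T. (\<Sum>\<beta>\<in>{\<beta> \<in> ?S. ?g \<beta> = \<gamma>}. c \<beta>) * monom_fun J \<gamma> x)"
      unfolding sum_distrib_right by (intro sum.cong) auto
    finally show ?thesis .
  qed
  then show ?case by (intro exI allI)
qed

text \<open>Monomials are linearly independent as functions. By induction the coefficient of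
  \<open>t ^ k0\<close> is nonzero at some \<open>y\<close>, and a univariate polynomial in the new
  variable \<open>t\<close> with a nonzero coefficient has a nonzero value.\<close>

lemma monom_combination_nonzero:
  assumes "finite J" "\<alpha>0 \<in> PiE J (\<lambda>_. {..<D})" "a \<alpha>0 \<noteq> 0"
  shows "\<exists>x. (\<Sum>\<alpha>\<in>PiE J (\<lambda>_. {..<D}). a \<alpha> * monom_fun J \<alpha> x) \<noteq> 0"
  using assms
proof (induction J arbitrary: a \<alpha>0 rule: finite_induct)
  case empty
  then show ?case by (simp add: monom_fun_def)
next
  case (insert j J)
  let ?S = "PiE J (\<lambda>_. {..<D})"
  define k0 where "k0 = \<alpha>0 j"
  have k0: "k0 < D" using insert.prems by (auto simp: k0_def)
  have S0: "restrict \<alpha>0 J \<in> ?S" using insert.prems by auto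
  have upd: "(restrict \<alpha>0 J)(j := k0) = \<alpha>0"
    using insert.prems insert.hyps by (auto simp: k0_def PiE_iff extensional_def fun_eq_iff)
  from insert.IH[OF S0, of "\<lambda>\<alpha>. a (\<alpha>(j := k0))"] insert.prems upd obtain y where
    y: "(\<Sum>\<alpha>\<in>?S. a (\<alpha>(j := k0)) * monom_fun J \<alpha> y) \<noteq> 0" by metis
  define q where "q = (\<Sum>k<D. monom (\<Sum>\<alpha>\<in>?S. a (\<alpha>(j := k)) * monom_fun J \<alpha> y) k)"
  have "coeff q k0 = (\<Sum>\<alpha>\<in>?S. a (\<alpha>(j := k0)) * monom_fun J \<alpha> y)"
    using k0 by (simp add: q_def coeff_sum)
  with y have "q \<noteq> 0" by auto
  then obtain t where t: "poly q t \<noteq> 0" using poly_all_0_iff_0 by blast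
  have inj: "inj_on (\<lambda>(k, \<alpha>). \<alpha>(j := k)) ({..<D} \<times> ?S)"
    using insert.hyps by (auto simp: inj_on_def PiE_iff extensional_def fun_eq_iff)
  have mono: "monom_fun (insert j J) (\<alpha>(j := k)) (y(j := t)) = t ^ k * monom_fun J \<alpha> y" for \<alpha> k
  proof -
    have "(\<Prod>i\<in>J. (y(j := t)) i ^ (\<alpha>(j := k)) i) = (\<Prod>i\<in>J. y i ^ \<alpha> i)"
      using insert.hyps by (intro prod.cong) auto
    then show ?thesis using insert.hyps by (simp add: monom_fun_def)
  qed
  have "(\<Sum>\<alpha>\<in>PiE (insert j J) (\<lambda>_. {..<D}). a \<alpha> * monom_fun (insert j J) \<alpha> (y(j := t)))
    = (\<Sum>(k, \<alpha>)\<in>{..<D} \<times> ?S. a (\<alpha>(j := k)) * monom_fun (insert j J) (\<alpha>(j := k)) (y(j := t)))"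
    unfolding PiE_insert_eq by (subst sum.reindex[OF inj]) (auto simp: case_prod_unfold o_def)
  also have "\<dots> = (\<Sum>k<D. \<Sum>\<alpha>\<in>?S. a (\<alpha>(j := k)) * (t ^ k * monom_fun J \<alpha> y))"
    unfolding mono by (rule sum.cartesian_product[symmetric])
  also have "\<dots> = poly q t"
    by (simp add: q_def poly_sum poly_monom sum_distrib_left sum_distrib_right mult_ac)
  finally show ?case using t by metis
qed

text \<open>There is one polynomial more than there are variables, so \<open>h\<close> and the
  components of \<phi> are algebraically dependent. The products of their powers with exponents
  below \<open>D\<close> outnumber the monomials in their expansions, hence a nontrivial linear
  combination of them is zero; \<open>B k\<close> collects the coefficients of
  \<open>h ^ k\<close>.\<close>

lemma algebraic_relation:
  fixes \<phi> :: "('j \<Rightarrow> real) \<Rightarrow> 'j \<Rightarrow> real"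
  assumes fin: "finite J" and \<phi>: "\<And>j. j \<in> J \<Longrightarrow> (\<lambda>w. \<phi> w j) \<in> poly_funs J"
    and h: "h \<in> poly_funs J"
  shows "\<exists>K B. (\<forall>k<K. B k \<in> poly_funs J) \<and> (\<exists>k<K. \<exists>u. B k u \<noteq> 0) \<and>
    (\<forall>w. (\<Sum>k<K. B k (\<phi> w) * h w ^ k) = 0)"
proof -
  have "\<forall>j\<in>J. \<exists>e. pdeg J e (\<lambda>w. \<phi> w j)" using \<phi> poly_funs_pdeg by blast
  then obtain e where e: "\<And>j. j \<in> J \<Longrightarrow> pdeg J (e j) (\<lambda>w. \<phi> w j)" by metis
  obtain eh where eh: "pdeg J eh h" using h poly_funs_pdeg by blast
  define E where "E = (\<Sum>j\<in>J. e j) + eh"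
  have E: "pdeg J E (\<lambda>w. \<phi> w j)" if "j \<in> J" for j
    using e[OF that] by (rule pdeg_mono) (simp add: E_def fin that member_le_sum trans_le_add1)
  have Eh: "pdeg J E h" using eh by (rule pdeg_mono) (simp add: E_def)
  define M where "M = card J"
  \<comment> \<open>Each product consists of \<open>M + 1\<close> powers, with exponents below
    \<open>D\<close>, of polynomials of degree at most \<open>E\<close>, so its degree is at most
    \<open>c * D\<close>. There are \<open>D ^ (M + 1)\<close> products and at most
    \<open>((c + 1) * D) ^ M\<close> monomials, so any \<open>D\<close> above
    \<open>(c + 1) ^ M\<close> will do.\<close>
  define c where "c = (M + 1) * E"
  define D where "D = (c + 1) ^ M + 1"
  define S where "S = PiE J (\<lambda>_. {..<D})"
  define T where "T = PiE J (\<lambda>_. {..c * D})"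
  have D: "(c + 1) ^ M < D" "1 \<le> D" by (simp_all add: D_def)
  have fins: "finite S" "finite T" using fin by (auto simp: S_def T_def intro: finite_PiE)
  have "card T = (c * D + 1) ^ M" using fin by (simp add: T_def card_PiE M_def)
  also have "\<dots> \<le> ((c + 1) * D) ^ M" using D by (intro power_mono) (auto simp: algebra_simps)
  also have "\<dots> = (c + 1) ^ M * D ^ M" by (rule power_mult_distrib)
  also have "\<dots> < D * D ^ M" using D by (intro mult_strict_right_mono) auto
  also have "\<dots> = card (S \<times> {..<D})" using fin by (simp add: S_def card_PiE M_def card_cartesian_product)
  finally have card: "card T < card (S \<times> {..<D})" .
  have "\<exists>C. \<forall>w. monom_fun J \<alpha> (\<phi> w) * h w ^ k = (\<Sum>\<beta>\<in>T. C \<beta> * monom_fun J \<beta> w)"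
    if "\<alpha> \<in> S" "k < D" for \<alpha> k
  proof -
    have "pdeg J ((\<Sum>j\<in>J. \<alpha> j * E) + k * E) (\<lambda>w. monom_fun J \<alpha> (\<phi> w) * h w ^ k)"
      unfolding monom_fun_def by (intro pdeg_mult pdeg_prod pdeg_power E Eh)
    moreover have "(\<Sum>j\<in>J. \<alpha> j * E) + k * E \<le> c * D"
    proof -
      have "(\<Sum>j\<in>J. \<alpha> j * E) \<le> (\<Sum>j\<in>J. D * E)"
        using that(1) by (intro sum_mono mult_right_mono) (auto simp: S_def PiE_iff less_imp_le)
      also have "\<dots> = M * (D * E)" by (simp add: M_def)
      finally have "(\<Sum>j\<in>J. \<alpha> j * E) \<le> M * (D * E)" .
      moreover have "k * E \<le> D * E" using that(2) by simp
      moreover have "c * D = M * (D * E) + D * E" by (simp add: c_def algebra_simps)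
      ultimately show ?thesis by linarith
    qed
    ultimately have "pdeg J (c * D) (\<lambda>w. monom_fun J \<alpha> (\<phi> w) * h w ^ k)" by (rule pdeg_mono)
    from pdeg_expand[OF this fin] show ?thesis by (simp add: T_def)
  qed
  then obtain C where C: "\<And>\<alpha> k w. \<alpha> \<in> S \<Longrightarrow> k < D \<Longrightarrow>
      monom_fun J \<alpha> (\<phi> w) * h w ^ k = (\<Sum>\<beta>\<in>T. C \<alpha> k \<beta> * monom_fun J \<beta> w)" by metis
  \<comment> \<open>The unknowns are the pairs (\<alpha>, k); equation \<beta> demands that the
    coefficient of that monomial in \<open>w\<close> vanishes.\<close>
  from underdetermined_system[OF fins(2) finite_cartesian_product[OF fins(1) finite_lessThan] card, of "\<lambda>p. C (fst p) (snd p)"]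
  obtain a where a: "\<exists>p\<in>S \<times> {..<D}. a p \<noteq> 0"
    "\<forall>\<beta>\<in>T. (\<Sum>p\<in>S \<times> {..<D}. a p * C (fst p) (snd p) \<beta>) = 0" by blast
  define B where "B = (\<lambda>k u. \<Sum>\<alpha>\<in>S. a (\<alpha>, k) * monom_fun J \<alpha> u)"
  have "B k \<in> poly_funs J" for k
    unfolding B_def by (intro poly_funs_sum poly_funs.mult poly_funs.const monom_fun_poly_funs)
  moreover have "\<exists>k<D. \<exists>u. B k u \<noteq> 0"
  proof -
    obtain \<alpha> k where k: "\<alpha> \<in> S" "k < D" "a (\<alpha>, k) \<noteq> 0" using a(1) by auto
    from monom_combination_nonzero[OF fin k(1)[unfolded S_def], of "\<lambda>\<alpha>. a (\<alpha>, k)"] k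
    show ?thesis unfolding B_def S_def by blast
  qed
  moreover have "(\<Sum>k<D. B k (\<phi> w) * h w ^ k) = 0" for w
  proof -
    have "(\<Sum>k<D. B k (\<phi> w) * h w ^ k) = (\<Sum>k<D. \<Sum>\<alpha>\<in>S. a (\<alpha>, k) * (monom_fun J \<alpha> (\<phi> w) * h w ^ k))"
      by (simp add: B_def sum_distrib_right mult.assoc)
    also have "\<dots> = (\<Sum>\<alpha>\<in>S. \<Sum>k<D. a (\<alpha>, k) * (\<Sum>\<beta>\<in>T. C \<alpha> k \<beta> * monom_fun J \<beta> w))"
      by (subst sum.swap) (intro sum.cong, auto simp: C)
    also have "\<dots> = (\<Sum>\<alpha>\<in>S. \<Sum>k<D. \<Sum>\<beta>\<in>T. a (\<alpha>, k) * C \<alpha> k \<beta> * monom_fun J \<beta> w)"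
      by (simp add: sum_distrib_left mult.assoc)
    also have "\<dots> = (\<Sum>(\<alpha>, k)\<in>S \<times> {..<D}. \<Sum>\<beta>\<in>T. a (\<alpha>, k) * C \<alpha> k \<beta> * monom_fun J \<beta> w)"
      by (rule sum.cartesian_product)
    also have "\<dots> = (\<Sum>\<beta>\<in>T. (\<Sum>p\<in>S \<times> {..<D}. a p * C (fst p) (snd p) \<beta>) * monom_fun J \<beta> w)"
      unfolding sum_distrib_right by (subst sum.swap) (simp add: case_prod_unfold)
    also have "\<dots> = 0" using a(2) by simp
    finally show ?thesis .
  qed
  ultimately show ?thesis by blast
qed

text \<open>In a relation between \<open>h\<close> and \<phi>, let \<open>B k0\<close> be the first
  nonzero coefficient. Without zero divisors the relation can be divided by \<open>h ^ k0\<close>;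
  where \<open>h\<close> vanishes only \<open>B k0 (\<phi> w)\<close> is left, so
  \<open>B k0\<close> serves as \<open>P\<close>.\<close>

lemma image_of_hypersurface:
  fixes \<phi> :: "('j \<Rightarrow> real) \<Rightarrow> 'j \<Rightarrow> real"
  assumes "finite J" "\<And>j. j \<in> J \<Longrightarrow> (\<lambda>w. \<phi> w j) \<in> poly_funs J" "h \<in> poly_funs J" "h a \<noteq> 0"
  shows "\<exists>P\<in>poly_funs J. (\<exists>u. P u \<noteq> 0) \<and> (\<forall>w. h w = 0 \<longrightarrow> P (\<phi> w) = 0)"
proof -
  obtain K B where B: "\<And>k. k < K \<Longrightarrow> B k \<in> poly_funs J" "\<exists>k<K. \<exists>u. B k u \<noteq> 0"
    "\<And>w. (\<Sum>k<K. B k (\<phi> w) * h w ^ k) = 0"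
    using algebraic_relation[of J \<phi> h] assms(1-3) by blast
  define k0 where "k0 = (LEAST k. k < K \<and> (\<exists>u. B k u \<noteq> 0))"
  have k0: "k0 < K" "\<exists>u. B k0 u \<noteq> 0"
    using LeastI_ex[of "\<lambda>k. k < K \<and> (\<exists>u. B k u \<noteq> 0)"] B(2) unfolding k0_def by blast+
  have small: "B k u = 0" if "k < k0" for k u
    using not_less_Least[of k "\<lambda>k. k < K \<and> (\<exists>u. B k u \<noteq> 0)"] that k0(1) unfolding k0_def by auto
  define q where "q = (\<lambda>w. \<Sum>k\<in>{k0..<K}. B k (\<phi> w) * h w ^ (k - k0))"
  have q: "q \<in> poly_funs J"
    unfolding q_def
    by (intro poly_funs_sum poly_funs.mult poly_funs_power assms(3) poly_funs_compose[OF B(1)])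
      (auto intro: assms(2))
  have "h w ^ k0 * q w = 0" for w
  proof -
    have "(\<Sum>k<K. B k (\<phi> w) * h w ^ k) = (\<Sum>k\<in>{k0..<K}. B k (\<phi> w) * h w ^ k)"
      using small by (intro sum.mono_neutral_right) auto
    also have "\<dots> = h w ^ k0 * q w"
      unfolding q_def sum_distrib_left
      by (intro sum.cong) (auto simp: power_add[symmetric] mult.left_commute)
    finally show ?thesis using B(3) by simp
  qed
  then have q0: "q w = 0" for w
    using poly_funs_mult_eq_0[OF poly_funs_power[OF assms(3), of k0] q] assms(4) by auto
  have "B k0 (\<phi> w) = 0" if "h w = 0" for w
  proof -
    have "q w = B k0 (\<phi> w) + (\<Sum>k\<in>{Suc k0..<K}. B k (\<phi> w) * h w ^ (k - k0))"
      using k0 by (simp add: q_def sum.atLeast_Suc_lessThan)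
    also have "(\<Sum>k\<in>{Suc k0..<K}. B k (\<phi> w) * h w ^ (k - k0)) = 0"
      using that by (intro sum.neutral) auto
    finally show ?thesis using q0 by simp
  qed
  then show ?thesis using k0 B(1) by blast
qed

text \<open>A polynomial counterpart of Sard's theorem. Take a relation \<open>\<Sum>\<^sub>k B\<^sub>k(\<phi>(w)) w\<^sub>j\<^sup>k = 0\<close> of minimal
  degree in \<open>w\<^sub>j\<close>. Differentiating it along \<open>v\<close> shows that its derivative with respect to \<open>w\<^sub>j\<close>,
  which is not identically zero by minimality, vanishes at \<open>w\<close>.\<close>

lemma critical_values_hypersurface:
  fixes \<phi> :: "('j \<Rightarrow> real) \<Rightarrow> 'j \<Rightarrow> real"
  assumes fin: "finite J" and \<phi>: "\<And>i. i \<in> J \<Longrightarrow> (\<lambda>w. \<phi> w i) \<in> poly_funs J" and j: "j \<in> J"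
  shows "\<exists>P\<in>poly_funs J. (\<exists>u. P u \<noteq> 0) \<and>
    (\<forall>w v. (\<forall>i\<in>J. ((\<lambda>t. \<phi> (\<lambda>l. w l + t * v l) i) has_real_derivative 0) (at 0)) \<longrightarrow>
       v j \<noteq> 0 \<longrightarrow> P (\<phi> w) = 0)"
proof -
  \<comment> \<open>The top coefficient has to be nonzero as a polynomial in \<open>u\<close>; it
    may still vanish on the image of \<phi>.\<close>
  define Q where "Q = (\<lambda>K. \<exists>B. (\<forall>k\<le>K. B k \<in> poly_funs J) \<and> (\<exists>u. B K u \<noteq> 0) \<and>
    (\<forall>w. (\<Sum>k\<le>K. B k (\<phi> w) * w j ^ k) = 0))"
  have ex: "\<exists>K. Q K"
  proof -
    obtain K B where B: "\<And>k. k < K \<Longrightarrow> B k \<in> poly_funs J" "\<exists>k<K. \<exists>u. B k u \<noteq> 0"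
      "\<And>w. (\<Sum>k<K. B k (\<phi> w) * w j ^ k) = 0"
      using algebraic_relation[of J \<phi> "\<lambda>w. w j"] fin \<phi> poly_funs.coord[OF j] by blast
    define S where "S = {k. k < K \<and> (\<exists>u. B k u \<noteq> 0)}"
    define K1 where "K1 = Max S"
    have S: "finite S" "S \<noteq> {}" using B(2) by (auto simp: S_def)
    have K1: "K1 < K" "\<exists>u. B K1 u \<noteq> 0" using Max_in[OF S] by (auto simp: S_def K1_def)
    have "B k u = 0" if "K1 < k" "k < K" for k u
      using Max_ge[OF S(1), of k] that by (fastforce simp: S_def K1_def)
    then have "(\<Sum>k<K. B k (\<phi> w) * w j ^ k) = (\<Sum>k\<le>K1. B k (\<phi> w) * w j ^ k)" for w
      using K1 by (intro sum.mono_neutral_right) auto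
    then show ?thesis using B K1 unfolding Q_def by (intro exI[of _ K1] exI[of _ B]) auto
  qed
  define K where "K = (LEAST K. Q K)"
  have "Q K" unfolding K_def using ex by (rule LeastI_ex)
  then obtain B where B: "\<And>k. k \<le> K \<Longrightarrow> B k \<in> poly_funs J" "\<exists>u. B K u \<noteq> 0"
    "\<And>w. (\<Sum>k\<le>K. B k (\<phi> w) * w j ^ k) = 0" unfolding Q_def by blast
  show ?thesis
  proof (cases K)
    \<comment> \<open>A relation of degree 0 says that the whole image of \<phi> lies in
      \<open>{B 0 = 0}\<close>.\<close>
    case 0
    then show ?thesis using B by (intro bexI[of _ "B 0"]) auto
  next
    case (Suc m)
    define B' where "B' = (\<lambda>k u. real (Suc k) * B (Suc k) u)"
    define h where "h = (\<lambda>w. \<Sum>k\<le>m. B' k (\<phi> w) * w j ^ k)"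
    have B': "B' k \<in> poly_funs J" if "k \<le> m" for k
      unfolding B'_def using that Suc by (intro poly_funs.mult poly_funs.const B(1)) auto
    \<comment> \<open>If \<open>h\<close> were identically zero, this would be a relation of degree
      \<open>m < K\<close>.\<close>
    have "\<not> Q m" using not_less_Least[of m Q] Suc by (simp add: K_def)
    moreover have "\<exists>u. B' m u \<noteq> 0" using B(2) Suc by (simp add: B'_def)
    ultimately obtain a where a: "h a \<noteq> 0" unfolding Q_def h_def using B' by blast
    have h: "h \<in> poly_funs J"
      unfolding h_def
      by (intro poly_funs_sum poly_funs.mult poly_funs_power poly_funs.coord j
          poly_funs_compose[OF B']) (auto intro: \<phi>)
    obtain P where P: "P \<in> poly_funs J" "\<exists>u. P u \<noteq> 0" "\<And>w. h w = 0 \<Longrightarrow> P (\<phi> w) = 0"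
      using image_of_hypersurface[of J \<phi> h a] fin \<phi> h a by blast
    have "h w = 0" if d: "\<And>i. i \<in> J \<Longrightarrow> ((\<lambda>t. \<phi> (\<lambda>l. w l + t * v l) i) has_real_derivative 0) (at 0)"
      and v: "v j \<noteq> 0" for w v
    proof -
      \<comment> \<open>The coefficients are stationary along \<open>v\<close> by assumption, so
        only the power of \<open>w j\<close> contributes to the derivative.\<close>
      have "((\<lambda>t. B k (\<phi> (\<lambda>l. w l + t * v l)) * (w j + t * v j) ^ k)
          has_real_derivative B k (\<phi> w) * (real k * w j ^ (k - 1) * v j)) (at 0)" if "k \<le> K" for k
      proof -
        have 1: "((\<lambda>t. B k (\<phi> (\<lambda>l. w l + t * v l))) has_real_derivative 0) (at 0)"
          using poly_funs_deriv_0[OF B(1)[OF that], of "\<lambda>t. \<phi> (\<lambda>l. w l + t * v l)" 0] d by blast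
        have 2: "((\<lambda>t. (w j + t * v j) ^ k) has_real_derivative real k * w j ^ (k - 1) * v j) (at 0)"
          by (auto intro!: derivative_eq_intros)
        show ?thesis using DERIV_mult[OF 1 2] by (simp add: mult.commute)
      qed
      then have "((\<lambda>t. \<Sum>k\<le>K. B k (\<phi> (\<lambda>l. w l + t * v l)) * (w j + t * v j) ^ k)
          has_real_derivative (\<Sum>k\<le>K. B k (\<phi> w) * (real k * w j ^ (k - 1) * v j))) (at 0)"
        by (intro DERIV_sum) auto
      moreover have "(\<Sum>k\<le>K. B k (\<phi> (\<lambda>l. w l + t * v l)) * (w j + t * v j) ^ k) = 0" for t
        using B(3)[of "\<lambda>l. w l + t * v l"] by simp
      ultimately have "(\<Sum>k\<le>K. B k (\<phi> w) * (real k * w j ^ (k - 1) * v j)) = 0"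
        using DERIV_unique[OF _ DERIV_const[of 0 "at 0"]] by simp
      moreover have "h w * v j = (\<Sum>k\<le>K. B k (\<phi> w) * (real k * w j ^ (k - 1) * v j))"
        unfolding Suc sum.atMost_Suc_shift
        by (simp add: h_def B'_def sum_distrib_left mult_ac)
      ultimately have "h w * v j = 0" by simp
      then show ?thesis using v by simp
    qed
    then show ?thesis using P by (intro bexI[of _ P]) blast+
  qed
qed

section \<open>Counting nondegenerate zeros\<close>

text \<open>The weights \<open>b\<close> define a linear functional by evaluation on
  \<open>S\<close>. The induction over \<open>pdeg\<close> moves one variable at a time from
  \<open>p\<close> into the exponent \<alpha>, until only monomials killed by the functional
  remain.\<close>

lemma pdeg_times_monom_annihilated:
  assumes "finite J" "pdeg J e p"
    "\<And>\<beta>. (\<Sum>j\<in>J. \<beta> j) \<le> (\<Sum>j\<in>J. \<alpha> j) + e \<Longrightarrow> (\<Sum>s\<in>S. b s * monom_fun J \<beta> s) = 0"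
  shows "(\<Sum>s\<in>S. b s * (p s * monom_fun J \<alpha> s)) = 0"
  using assms(2,3)
proof (induction arbitrary: \<alpha> rule: pdeg.induct)
  case (const e c)
  have "(\<Sum>s\<in>S. b s * (c * monom_fun J \<alpha> s)) = c * (\<Sum>s\<in>S. b s * monom_fun J \<alpha> s)"
    by (simp add: sum_distrib_left mult_ac)
  then show ?case using const by simp
next
  case (add e p q)
  then show ?case by (simp add: distrib_right distrib_left sum.distrib)
next
  case (shift j e p)
  have "(\<Sum>i\<in>J. (\<alpha>(j := Suc (\<alpha> j))) i) = Suc (\<Sum>i\<in>J. \<alpha> i)"
  proof -
    have "(\<Sum>i\<in>J - {j}. (\<alpha>(j := Suc (\<alpha> j))) i) = (\<Sum>i\<in>J - {j}. \<alpha> i)" by (rule sum.cong) auto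
    then show ?thesis using assms(1) shift(1) by (simp add: sum.remove[of J j])
  qed
  then have "(\<Sum>s\<in>S. b s * (p s * monom_fun J (\<alpha>(j := Suc (\<alpha> j))) s)) = 0"
    using shift.prems by (intro shift.IH) simp
  then show ?case using assms(1) shift(1) by (simp add: monom_fun_Suc mult_ac)
qed

text \<open>Modulo the equations every polynomial is a combination of the monomials with exponents
  below \<open>D\<close>. A larger set of zeros would carry a nonzero functional that kills all these
  monomials, hence all polynomials, although polynomials separate points.\<close>

lemma card_common_zeros_le:
  fixes L :: "'m::finite \<Rightarrow> ('m \<Rightarrow> real) \<Rightarrow> real"
  assumes D: "\<And>j. 1 \<le> D j" and L: "\<And>j. pdeg UNIV (D j - 1) (L j)" and c: "\<And>j. c j \<noteq> 0"
    and S: "finite S" "\<And>s j. s \<in> S \<Longrightarrow> c j * s j ^ D j + L j s = 0"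
  shows "card S \<le> (\<Prod>j\<in>UNIV. D j)"
proof (rule ccontr)
  \<comment> \<open>\<open>T\<close> has exactly as many elements as the claimed bound.\<close>
  define T :: "('m \<Rightarrow> nat) set" where "T = PiE UNIV (\<lambda>j. {..<D j})"
  assume "\<not> ?thesis"
  then have card: "card T < card S" by (simp add: T_def card_PiE)
  have "finite T" unfolding T_def by (intro finite_PiE) auto
  from underdetermined_system[OF this S(1) card, of "\<lambda>s \<beta>. monom_fun UNIV \<beta> s"]
  obtain b where b: "\<exists>s\<in>S. b s \<noteq> 0"
    "\<And>\<beta>. \<beta> \<in> T \<Longrightarrow> (\<Sum>s\<in>S. b s * monom_fun UNIV \<beta> s) = 0" by blast
  have kill: "(\<Sum>s\<in>S. b s * monom_fun UNIV \<alpha> s) = 0" for \<alpha>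
  proof (induction "\<Sum>j\<in>UNIV. \<alpha> j" arbitrary: \<alpha> rule: less_induct)
    case less
    show ?case
    proof (cases "\<alpha> \<in> T")
      case True
      then show ?thesis by (rule b)
    next
      case False
      \<comment> \<open>The monomial contains \<open>s j ^ D j\<close>, which equation
        \<open>j\<close> replaces by \<open>- L j s / c j\<close>. This lowers the total degree,
        because \<open>L j\<close> has degree at most \<open>D j - 1\<close>.\<close>
      then obtain j where j: "D j \<le> \<alpha> j" by (auto simp: T_def PiE_iff not_less)
      define \<alpha>' where "\<alpha>' = \<alpha>(j := \<alpha> j - D j)"
      have "(\<Sum>i\<in>UNIV - {j}. \<alpha>' i) = (\<Sum>i\<in>UNIV - {j}. \<alpha> i)" by (rule sum.cong) (auto simp: \<alpha>'_def)
      then have deg: "(\<Sum>i\<in>UNIV. \<alpha>' i) + D j = (\<Sum>i\<in>UNIV. \<alpha> i)"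
        using j by (simp add: sum.remove[of UNIV j] \<alpha>'_def)
      have mono: "monom_fun UNIV \<alpha> s = s j ^ D j * monom_fun UNIV \<alpha>' s" for s
      proof -
        have "(\<Prod>i\<in>UNIV - {j}. s i ^ \<alpha>' i) = (\<Prod>i\<in>UNIV - {j}. s i ^ \<alpha> i)"
          by (rule prod.cong) (auto simp: \<alpha>'_def)
        moreover have "s j ^ \<alpha> j = s j ^ D j * s j ^ \<alpha>' j"
          using j by (simp add: \<alpha>'_def power_add[symmetric])
        ultimately show ?thesis by (simp add: monom_fun_def prod.remove[of UNIV j] mult_ac)
      qed
      have "(\<Sum>s\<in>S. b s * (L j s * monom_fun UNIV \<alpha>' s)) = 0"
      proof (rule pdeg_times_monom_annihilated[OF _ L])
        fix \<beta> :: "'m \<Rightarrow> nat"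
        assume "(\<Sum>j\<in>UNIV. \<beta> j) \<le> (\<Sum>j\<in>UNIV. \<alpha>' j) + (D j - 1)"
        then have "(\<Sum>j\<in>UNIV. \<beta> j) < (\<Sum>j\<in>UNIV. \<alpha> j)" using deg D[of j] by linarith
        then show "(\<Sum>s\<in>S. b s * monom_fun UNIV \<beta> s) = 0" by (rule less)
      qed simp
      moreover have "(\<Sum>s\<in>S. b s * (L j s * monom_fun UNIV \<alpha>' s))
        = (\<Sum>s\<in>S. - c j * (b s * monom_fun UNIV \<alpha> s))"
      proof (rule sum.cong)
        fix s assume "s \<in> S"
        then have "L j s = - c j * s j ^ D j" using S(2)[of s j] by linarith
        then show "b s * (L j s * monom_fun UNIV \<alpha>' s) = - c j * (b s * monom_fun UNIV \<alpha> s)"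
          by (simp add: mono)
      qed simp
      ultimately show ?thesis using c[of j] by (simp add: sum_distrib_left[symmetric] sum_negf)
    qed
  qed
  obtain s0 where s0: "s0 \<in> S" "b s0 \<noteq> 0" using b(1) by blast
  have "\<forall>s\<in>S - {s0}. \<exists>j. s j \<noteq> s0 j" by auto
  then obtain i where i: "\<And>s. s \<in> S - {s0} \<Longrightarrow> s (i s) \<noteq> s0 (i s)" by metis
  \<comment> \<open>This polynomial vanishes on \<open>S - {s0}\<close> but not at
    \<open>s0\<close>, so the functional takes the nonzero value \<open>b s0 * p s0\<close> on
    it.\<close>
  define p where "p = (\<lambda>x :: 'm \<Rightarrow> real. \<Prod>s\<in>S - {s0}. x (i s) - s (i s))"
  have p: "pdeg UNIV (\<Sum>s\<in>S - {s0}. Suc 0) p"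
    unfolding p_def by (intro pdeg_prod pdeg_diff pdeg_coord pdeg.const UNIV_I)
  have "(\<Sum>s\<in>S. b s * (p s * monom_fun UNIV (\<lambda>_. 0) s)) = 0"
    by (intro pdeg_times_monom_annihilated[OF _ p, where b = b and S = S] kill) simp
  then have "(\<Sum>s\<in>S. b s * p s) = 0" by (simp add: monom_fun_def)
  moreover have "p s = 0" if "s \<in> S - {s0}" for s
    using that S(1) by (auto simp: p_def)
  ultimately have "b s0 * p s0 = 0" using s0(1) S(1) by (simp add: sum.remove)
  moreover have "p s0 \<noteq> 0" using i S(1) by (force simp: p_def)
  ultimately show False using s0 by simp
qed

text \<open>The parameter \<epsilon> becomes a variable: \<open>H\<close> maps (\<epsilon>, z) to
  (\<epsilon>, F z + \<epsilon> G z), and its derivative at (0, z0) is invertible. An open mapping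
  theorem then puts (\<epsilon>, 0) into the image of \<open>T\<close> for all small
  \<epsilon>.\<close>

lemma zero_persists:
  fixes F G :: "'a::euclidean_space \<Rightarrow> 'a"
  assumes F: "\<And>z. F differentiable (at z)" and G: "\<And>z. G differentiable (at z)"
    and z0: "F z0 = 0" "(F has_derivative F') (at z0)" "inj F'" and \<delta>: "0 < \<delta>"
  shows "\<exists>\<epsilon>0>0. \<forall>\<epsilon>. 0 < \<epsilon> \<longrightarrow> \<epsilon> < \<epsilon>0 \<longrightarrow> (\<exists>z\<in>ball z0 \<delta>. F z + \<epsilon> *\<^sub>R G z = 0)"
proof -
  define H :: "real \<times> 'a \<Rightarrow> real \<times> 'a" where "H = (\<lambda>p. (fst p, F (snd p) + fst p *\<^sub>R G (snd p)))"
  define H' :: "real \<times> 'a \<Rightarrow> real \<times> 'a" where "H' = (\<lambda>q. (fst q, F' (snd q) + fst q *\<^sub>R G z0))"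
  have cF: "continuous_on UNIV F" and cG: "continuous_on UNIV G"
    using F G differentiable_imp_continuous_on[of _ UNIV] by (auto simp: differentiable_on_def)
  have cH: "continuous_on UNIV H"
    unfolding H_def
    by (intro continuous_intros continuous_on_compose2[OF cF] continuous_on_compose2[OF cG]) auto
  obtain G' where G': "(G has_derivative G') (at z0)" using G by (auto simp: differentiable_def)
  have dsnd: "(snd has_derivative snd) (at (0::real, z0))"
    by (rule bounded_linear_imp_has_derivative[OF bounded_linear_snd])
  have dF: "((\<lambda>p. F (snd p)) has_derivative (\<lambda>q. F' (snd q))) (at (0::real, z0))"
    using has_derivative_compose[OF dsnd, of F F'] z0(2) by simp
  have dG: "((\<lambda>p. G (snd p)) has_derivative (\<lambda>q. G' (snd q))) (at (0::real, z0))"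
    using has_derivative_compose[OF dsnd, of G G'] G' by simp
  have dH: "(H has_derivative H') (at (0, z0))"
    unfolding H_def H'_def
    by (rule derivative_eq_intros dF dG | simp)+
  have "linear H'" using dH by (meson has_derivative_linear)
  have lF: "linear F'" using z0(2) by (rule has_derivative_linear)
  have "inj H'"
  proof (rule injI)
    fix p q assume "H' p = H' q"
    then have "fst p = fst q" "F' (snd p) = F' (snd q)" by (auto simp: H'_def)
    then show "p = q" using z0(3) by (auto simp: inj_eq prod_eq_iff)
  qed
  then have "surj H'" using \<open>linear H'\<close> linear_injective_imp_surjective by blast
  then obtain K where K: "linear K" "H' \<circ> K = id"
    using linear_surjective_right_inverse[OF \<open>linear H'\<close>] by blast
  define T :: "(real \<times> 'a) set" where "T = UNIV \<times> ball z0 \<delta>"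
  have "H (0, z0) \<in> interior (H ` T)"
  proof (rule sussmann_open_mapping[OF open_UNIV cH _ dH _ K(2)])
    show "bounded_linear K" using K(1) linear_conv_bounded_linear by blast
    have "open T" unfolding T_def by (intro open_Times) auto
    then show "(0, z0) \<in> interior T" using \<delta> by (simp add: interior_open T_def)
  qed auto
  then obtain e where e: "e > 0" "ball (0, 0) e \<subseteq> H ` T"
    by (auto simp: mem_interior H_def z0(1))
  have "\<exists>z\<in>ball z0 \<delta>. F z + \<epsilon> *\<^sub>R G z = 0" if "0 < \<epsilon>" "\<epsilon> < e" for \<epsilon>
  proof -
    have "(\<epsilon>, 0) \<in> ball (0, 0 :: 'a) e" using that by (simp add: dist_Pair_Pair)
    then obtain p where "p \<in> T" "H p = (\<epsilon>, 0)" using e(2) by (metis imageE subsetD)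
    then show ?thesis by (auto simp: H_def T_def)
  qed
  then show ?thesis using e(1) by blast
qed

lemma pdeg_differentiable:
  "pdeg UNIV e p \<Longrightarrow> (\<lambda>z :: real^'m. p (vec_nth z)) differentiable (at z)"
proof (induction rule: pdeg.induct)
  case (shift j e p)
  have "(\<lambda>z :: real^'m. z $ j) differentiable (at z)"
    by (rule bounded_linear_imp_differentiable[OF bounded_linear_vec_nth])
  then show ?case using shift by (intro differentiable_mult)
next
  case (add e p q)
  then show ?case by (intro differentiable_add)
qed simp

lemma differentiable_vec:
  fixes f :: "real^'m \<Rightarrow> real^'k"
  assumes "\<And>j. (\<lambda>z. f z $ j) differentiable (at z)"
  shows "f differentiable (at z)"
proof -
  obtain f' where "\<And>j. ((\<lambda>z. f z $ j) has_derivative f' j) (at z)"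
    using assms unfolding differentiable_def by metis
  then have "(f has_derivative (\<lambda>y. \<chi> j. f' j y)) (at z)"
    by (subst has_derivative_componentwise_within) (auto simp: Basis_vec_def inner_axis)
  then show ?thesis unfolding differentiable_def by blast
qed

text \<open>In the perturbed system the leading coefficients \<open>c j + \<epsilon>\<close> are
  positive, so \<open>card_common_zeros_le\<close> applies. Nondegenerate zeros move only slightly
  under a small perturbation, so finitely many of them give as many distinct perturbed zeros.
  Nondegeneracy is expressed by derivatives along lines to match \<open>kkt_tangent\<close>.\<close>

lemma nondegenerate_zeros:
  fixes L :: "'m::finite \<Rightarrow> ('m \<Rightarrow> real) \<Rightarrow> real" and F :: "real^'m \<Rightarrow> real^'m"
  assumes D: "\<And>j. 1 \<le> D j" and L: "\<And>j. pdeg UNIV (D j - 1) (L j)" and c: "\<And>j. 0 \<le> c j"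
    and F: "\<And>z j. F z $ j = c j * (z $ j) ^ D j + L j (vec_nth z)"
    and nondeg: "\<And>z v. F z = 0 \<Longrightarrow>
      (\<And>j. ((\<lambda>t. F (z + t *\<^sub>R v) $ j) has_real_derivative 0) (at 0)) \<Longrightarrow> v = 0"
  shows "finite {z. F z = 0} \<and> card {z. F z = 0} \<le> (\<Prod>j\<in>UNIV. D j)"
proof -
  define G where "G = (\<lambda>z :: real^'m. \<chi> j. (z $ j) ^ D j)"
  have dpow: "(\<lambda>z :: real^'m. z $ j ^ k) differentiable (at z)" for j k z
    by (intro differentiable_power bounded_linear_imp_differentiable[OF bounded_linear_vec_nth])
  have dF: "F differentiable (at z)" for z
    by (rule differentiable_vec) (auto simp: F intro!: differentiable_add differentiable_mult dpow
        pdeg_differentiable[OF L])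
  have dG: "G differentiable (at z)" for z
    by (rule differentiable_vec) (auto simp: G_def intro!: dpow)
  have bound: "card S \<le> (\<Prod>j\<in>UNIV. D j)" if S: "finite S" "S \<subseteq> {z. F z = 0}" for S
  proof -
    \<comment> \<open>With this \<delta> the balls around distinct points of \<open>S\<close> are
      disjoint.\<close>
    obtain \<delta> where \<delta>: "0 < \<delta>" "\<And>x y. x \<in> S \<Longrightarrow> y \<in> S \<Longrightarrow> x \<noteq> y \<Longrightarrow> 2 * \<delta> \<le> dist x y"
    proof -
      have "finite ((\<lambda>(x, y). dist x y) ` (S \<times> S) - {0})" using S(1) by simp
      then obtain m where "0 < m" "\<And>d. d \<in> (\<lambda>(x, y). dist x y) ` (S \<times> S) - {0} \<Longrightarrow> m \<le> d"
      proof -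
        \<comment> \<open>Inserting 1 keeps the minimum defined when \<open>S\<close> has at most
          one point.\<close>
        let ?R = "insert 1 ((\<lambda>(x, y). dist x y) ` (S \<times> S) - {0})"
        assume *: "\<And>m. 0 < m \<Longrightarrow> (\<And>d. d \<in> (\<lambda>(x, y). dist x y) ` (S \<times> S) - {0} \<Longrightarrow> m \<le> d) \<Longrightarrow> thesis"
        have R: "finite ?R" using S(1) by simp
        then have "Min ?R \<in> ?R" by (intro Min_in) auto
        then have "0 < Min ?R" by (auto simp: less_le)
        then show thesis using R by (intro *[of "Min ?R"]) (auto intro: Min_le)
      qed
      then show thesis by (intro that[of "m / 2"]) fastforce+
    qed
    have "\<exists>\<epsilon>0>0. \<forall>\<epsilon>. 0 < \<epsilon> \<longrightarrow> \<epsilon> < \<epsilon>0 \<longrightarrow> (\<exists>z\<in>ball s \<delta>. F z + \<epsilon> *\<^sub>R G z = 0)" if "s \<in> S" for s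
    proof -
      obtain F' where F': "(F has_derivative F') (at s)" using dF by (auto simp: differentiable_def)
      then have lin: "linear F'" by (rule has_derivative_linear)
      have "v = 0" if "F' v = 0" for v
      proof (rule nondeg)
        show "F s = 0" using \<open>s \<in> S\<close> S(2) by auto
        fix j
        have "((\<lambda>t. s + t *\<^sub>R v) has_derivative (\<lambda>t. t *\<^sub>R v)) (at 0)"
          by (auto intro!: derivative_eq_intros)
        from has_derivative_compose[OF this, of F F'] F'
        have "((\<lambda>t. F (s + t *\<^sub>R v)) has_derivative (\<lambda>t. F' (t *\<^sub>R v))) (at 0)" by simp
        then have "((\<lambda>t. F (s + t *\<^sub>R v) $ j) has_derivative (\<lambda>t. F' (t *\<^sub>R v) $ j)) (at 0)"
          by (rule bounded_linear.has_derivative[OF bounded_linear_vec_nth])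
        moreover have "(\<lambda>t. F' (t *\<^sub>R v) $ j) = (*) 0"
          using that by (auto simp: linear_scale[OF lin])
        ultimately show "((\<lambda>t. F (s + t *\<^sub>R v) $ j) has_real_derivative 0) (at 0)"
          by (simp add: has_field_derivative_def)
      qed
      then have "inj F'" using lin by (simp add: linear_injective_0)
      then show ?thesis using zero_persists[OF dF dG _ F' _ \<delta>(1)] that S(2) by blast
    qed
    then obtain e where e: "\<And>s. s \<in> S \<Longrightarrow> e s > 0"
      "\<And>s \<epsilon>. s \<in> S \<Longrightarrow> 0 < \<epsilon> \<Longrightarrow> \<epsilon> < e s \<Longrightarrow> \<exists>z\<in>ball s \<delta>. F z + \<epsilon> *\<^sub>R G z = 0"
      by metis
    \<comment> \<open>One \<epsilon> that works for all points of \<open>S\<close>; the 1 covers the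
      case of empty \<open>S\<close>.\<close>
    define \<epsilon> where "\<epsilon> = Min (insert 1 (e ` S)) / 2"
    have "Min (insert 1 (e ` S)) \<in> insert 1 (e ` S)" using S(1) by (intro Min_in) auto
    then have pos: "0 < Min (insert 1 (e ` S))" using e(1) by auto
    then have \<epsilon>: "0 < \<epsilon>" by (simp add: \<epsilon>_def)
    have "\<epsilon> < e s" if "s \<in> S" for s
    proof -
      have "Min (insert 1 (e ` S)) \<le> e s" using that S(1) by (intro Min_le) auto
      then show ?thesis using pos by (simp add: \<epsilon>_def)
    qed
    then have "\<forall>s\<in>S. \<exists>z. z \<in> ball s \<delta> \<and> F z + \<epsilon> *\<^sub>R G z = 0" using e(2) \<epsilon> by blast
    then obtain z where z: "\<And>s. s \<in> S \<Longrightarrow> z s \<in> ball s \<delta>" "\<And>s. s \<in> S \<Longrightarrow> F (z s) + \<epsilon> *\<^sub>R G (z s) = 0"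
      by metis
    have "inj_on z S"
    proof (rule inj_onI, rule ccontr)
      fix x y assume xy: "x \<in> S" "y \<in> S" "z x = z y" "x \<noteq> y"
      have "dist x y \<le> dist x (z x) + dist y (z x)" by (rule dist_triangle2)
      also have "\<dots> < 2 * \<delta>" using z(1)[OF xy(1)] z(1)[OF xy(2)] xy(3) by simp
      finally show False using \<delta>(2)[OF xy(1,2,4)] by simp
    qed
    moreover have "inj vec_nth" by (simp add: inj_def vec_nth_inject)
    ultimately have "card ((\<lambda>s. vec_nth (z s)) ` S) = card S"
      by (intro card_image) (auto simp: inj_on_def)
    moreover have "card ((\<lambda>s. vec_nth (z s)) ` S) \<le> (\<Prod>j\<in>UNIV. D j)"
    proof (rule card_common_zeros_le[OF D L])
      show "c j + \<epsilon> \<noteq> 0" for j using c[of j] \<epsilon> by linarith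
      show "(c j + \<epsilon>) * y j ^ D j + L j y = 0" if y: "y \<in> (\<lambda>s. vec_nth (z s)) ` S" for y j
      proof -
        obtain s where s: "s \<in> S" "y = vec_nth (z s)" using y by blast
        have "(F (z s) + \<epsilon> *\<^sub>R G (z s)) $ j = 0" using z(2)[OF s(1)] by simp
        then show ?thesis by (simp add: F G_def s(2) algebra_simps)
      qed
    qed (use S in simp)
    ultimately show ?thesis by simp
  qed
  \<comment> \<open>All finite sets of zeros obey the same bound, which excludes infinitely many
    zeros.\<close>
  have fin: "finite {z. F z = 0}"
  proof (rule ccontr)
    assume "infinite {z. F z = 0}"
    then obtain S where "S \<subseteq> {z. F z = 0}" "finite S" "card S = Suc (\<Prod>j\<in>UNIV. D j)"
      using infinite_arbitrarily_large by blast
    then show False using bound[of S] by simp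
  qed
  then show ?thesis using bound by blast
qed

section \<open>Critical points of continuous selections\<close>

text \<open>The set of \<open>s\<close> with \<open>h s \<le> h 0\<close> is closed and so contains
  its supremum; if that were below \<open>t\<close>, the step property would give a larger
  member.\<close>

lemma nonincreasing_if_locally:
  fixes h :: "real \<Rightarrow> real"
  assumes "0 \<le> t" "continuous_on {0..t} h"
    and step: "\<And>s. 0 \<le> s \<Longrightarrow> s < t \<Longrightarrow> \<exists>s'>s. s' \<le> t \<and> h s' \<le> h s"
  shows "h t \<le> h 0"
proof -
  define T where "T = {s \<in> {0..t}. h s \<le> h 0}"
  have T: "0 \<in> T" "bdd_above T" using assms(1) by (auto simp: T_def intro: bdd_aboveI[of _ t])
  have "T = {0..t} \<inter> h -` {..h 0}" by (auto simp: T_def)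
  then have "closed T"
    using continuous_closed_preimage[OF assms(2) closed_atLeastAtMost closed_atMost] by simp
  then have s0: "Sup T \<in> T" using T by (intro closed_contains_Sup) auto
  have "Sup T = t"
  proof (rule ccontr)
    assume "Sup T \<noteq> t"
    then have "0 \<le> Sup T" "Sup T < t" using s0 by (auto simp: T_def)
    from step[OF this] obtain s' where s': "Sup T < s'" "s' \<le> t" "h s' \<le> h (Sup T)" by blast
    then have "s' \<in> T" using s0 by (auto simp: T_def)
    then show False using cSup_upper[OF _ T(2)] s'(1) by fastforce
  qed
  then show ?thesis using s0 by (auto simp: T_def)
qed

text \<open>The function \<open>h s = f (y + s *\<^sub>R v) + b * s\<close> does not increase along
  the segment. Just to the right of \<open>s\<close> only pieces active at \<open>s\<close> can be
  active, by continuity and finiteness of \<open>I\<close>, and those have slope below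
  \<open>- b\<close> at \<open>s\<close>.\<close>

lemma selection_descent:
  fixes g :: "'i \<Rightarrow> 'a::real_inner \<Rightarrow> real"
  assumes "finite I" and g: "\<And>i y. i \<in> I \<Longrightarrow> GDERIV (g i) y :> G i y"
    and f: "continuous_on UNIV f" "\<And>y. f y \<in> (\<lambda>i. g i y) ` I"
    and t: "0 \<le> t"
    and act: "\<And>i s. i \<in> I \<Longrightarrow> 0 \<le> s \<Longrightarrow> s \<le> t \<Longrightarrow> g i (y + s *\<^sub>R v) = f (y + s *\<^sub>R v) \<Longrightarrow>
      G i (y + s *\<^sub>R v) \<bullet> v < - b"
  shows "f (y + t *\<^sub>R v) - f y \<le> - b * t"
proof -
  define h where "h = (\<lambda>s. f (y + s *\<^sub>R v) + b * s)"
  have der: "((\<lambda>s. g i (y + s *\<^sub>R v) + b * s) has_real_derivative G i (y + s *\<^sub>R v) \<bullet> v + b) (at s)"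
    if "i \<in> I" for i s
  proof -
    have "((\<lambda>s. y + s *\<^sub>R v) has_derivative (\<lambda>t. t *\<^sub>R v)) (at s)"
      by (auto intro!: derivative_eq_intros)
    from has_derivative_compose[OF this g[OF that, unfolded gderiv_def]]
    have "((\<lambda>s. g i (y + s *\<^sub>R v)) has_real_derivative G i (y + s *\<^sub>R v) \<bullet> v) (at s)"
      by (simp add: has_field_derivative_def inner_commute mult_commute_abs)
    from DERIV_add[OF this DERIV_cmult_Id] show ?thesis .
  qed
  have cf: "continuous_on UNIV (\<lambda>s. f (y + s *\<^sub>R v))"
    by (intro continuous_on_compose2[OF f(1)] continuous_intros) auto
  have ch: "continuous_on UNIV h" unfolding h_def by (intro continuous_intros cf)
  have "h t \<le> h 0"
  proof (rule nonincreasing_if_locally[OF t continuous_on_subset[OF ch subset_UNIV]])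
    fix s assume s: "0 \<le> s" "s < t"
    have "\<forall>i\<in>I. eventually (\<lambda>s'. g i (y + s' *\<^sub>R v) = f (y + s' *\<^sub>R v) \<longrightarrow> h s' \<le> h s) (at_right s)"
    proof
      fix i assume i: "i \<in> I"
      show "eventually (\<lambda>s'. g i (y + s' *\<^sub>R v) = f (y + s' *\<^sub>R v) \<longrightarrow> h s' \<le> h s) (at_right s)"
      proof (cases "g i (y + s *\<^sub>R v) = f (y + s *\<^sub>R v)")
        case True
        then have "G i (y + s *\<^sub>R v) \<bullet> v + b < 0" using act[OF i] s by fastforce
        from DERIV_neg_dec_right[OF der[OF i] this] obtain e where e: "e > 0"
          "\<And>k. 0 < k \<Longrightarrow> k < e \<Longrightarrow>
             g i (y + (s + k) *\<^sub>R v) + b * (s + k) < g i (y + s *\<^sub>R v) + b * s" by blast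
        have "g i (y + s' *\<^sub>R v) = f (y + s' *\<^sub>R v) \<longrightarrow> h s' \<le> h s" if "s < s'" "s' < s + e" for s'
          using e(2)[of "s' - s"] that True by (auto simp: h_def)
        then show ?thesis unfolding eventually_at_right_field
          using e(1) by (intro exI[of _ "s + e"]) auto
      next
        case False
        have "continuous_on UNIV (\<lambda>s. (g i (y + s *\<^sub>R v) + b * s) - h s)"
          by (intro continuous_intros ch DERIV_continuous_on[OF der[OF i]])
        then have "isCont (\<lambda>s. (g i (y + s *\<^sub>R v) + b * s) - h s) s"
          by (simp add: continuous_on_eq_continuous_at)
        then have "((\<lambda>s. (g i (y + s *\<^sub>R v) + b * s) - h s) \<longlongrightarrow> (g i (y + s *\<^sub>R v) + b * s) - h s) (at_right s)"
          by (simp add: isCont_def filterlim_at_split)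
        moreover have "(g i (y + s *\<^sub>R v) + b * s) - h s \<noteq> 0" using False by (simp add: h_def)
        ultimately have "eventually (\<lambda>s. (g i (y + s *\<^sub>R v) + b * s) - h s \<noteq> 0) (at_right s)"
          by (rule tendsto_imp_eventually_ne)
        then show ?thesis by eventually_elim (auto simp: h_def)
      qed
    qed
    then have "eventually (\<lambda>s'. \<forall>i\<in>I. g i (y + s' *\<^sub>R v) = f (y + s' *\<^sub>R v) \<longrightarrow> h s' \<le> h s) (at_right s)"
      by (rule eventually_ball_finite[OF assms(1)])
    moreover have "eventually (\<lambda>s'. s' \<in> {s<..<t}) (at_right s)"
      using s(2) by (rule eventually_at_right_real)
    ultimately have "eventually (\<lambda>s'. s < s' \<and> s' \<le> t \<and> h s' \<le> h s) (at_right s)"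
    proof eventually_elim
      case (elim s')
      obtain i where "i \<in> I" "f (y + s' *\<^sub>R v) = g i (y + s' *\<^sub>R v)" using f(2)[of "y + s' *\<^sub>R v"] by blast
      with elim show ?case by auto
    qed
    then show "\<exists>s'>s. s' \<le> t \<and> h s' \<le> h s"
      using eventually_happens'[OF trivial_limit_at_right_real] by blast
  qed
  then show ?thesis by (simp add: h_def)
qed

text \<open>If \<open>0\<close> were not a convex combination of the active gradients at \<open>x\<close>, separation would give
  a direction \<open>v\<close> along which all active gradients near \<open>x\<close> have slope below \<open>- b < 0\<close>, and then so would every difference quotient of \<open>f\<close> near \<open>x\<close>.\<close>

lemma critical_selection_multiplier:
  fixes g :: "'i \<Rightarrow> 'a::euclidean_space \<Rightarrow> real"
  assumes "finite I" and g: "\<And>i y. i \<in> I \<Longrightarrow> GDERIV (g i) y :> G i y"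
    and G: "\<And>i. i \<in> I \<Longrightarrow> continuous_on UNIV (G i)"
    and f: "continuous_on UNIV f" "\<And>y. f y \<in> (\<lambda>i. g i y) ` I"
    and crit: "critical_point f x" and A: "A = {i \<in> I. g i x = f x}"
  shows "\<exists>\<mu>. (\<forall>i\<in>A. 0 \<le> \<mu> i) \<and> (\<Sum>i\<in>A. \<mu> i) = 1 \<and> (\<Sum>i\<in>A. \<mu> i *\<^sub>R G i x) = 0"
proof -
  have finA: "finite A" using assms(1) A by simp
  have "0 \<in> convex hull ((\<lambda>i. G i x) ` A)"
  proof (rule ccontr)
    assume "0 \<notin> convex hull ((\<lambda>i. G i x) ` A)"
    moreover have "closed (convex hull ((\<lambda>i. G i x) ` A))"
      using finA by (intro compact_imp_closed finite_imp_compact_convex_hull) simp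
    ultimately obtain a b where ab: "0 < b" "\<forall>z\<in>convex hull ((\<lambda>i. G i x) ` A). b < a \<bullet> z"
      using separating_hyperplane_closed_0[OF convex_convex_hull] by blast
    define v where "v = - a"
    have slope: "G i x \<bullet> v < - b" if "i \<in> A" for i
    proof -
      have "G i x \<in> convex hull ((\<lambda>i. G i x) ` A)" using that by (simp add: hull_inc)
      then have "b < a \<bullet> G i x" using ab(2) by blast
      then show ?thesis by (simp add: v_def inner_commute[of _ a])
    qed
    \<comment> \<open>Pieces inactive at \<open>x\<close> stay inactive nearby, so for them the
      implication holds vacuously.\<close>
    have "\<forall>i\<in>I. eventually (\<lambda>y. g i y = f y \<longrightarrow> G i y \<bullet> v < - b) (nhds x)"
    proof
      fix i assume i: "i \<in> I"
      show "eventually (\<lambda>y. g i y = f y \<longrightarrow> G i y \<bullet> v < - b) (nhds x)"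
      proof (cases "i \<in> A")
        case True
        have "continuous_on UNIV (\<lambda>y. G i y \<bullet> v)" by (intro continuous_intros G i)
        then have "isCont (\<lambda>y. G i y \<bullet> v) x" by (simp add: continuous_on_eq_continuous_at)
        then have "((\<lambda>y. G i y \<bullet> v) \<longlongrightarrow> G i x \<bullet> v) (nhds x)"
          unfolding isCont_def by (rule tendsto_at_iff_tendsto_nhds[THEN iffD1])
        then have "eventually (\<lambda>y. G i y \<bullet> v < - b) (nhds x)"
          using slope[OF True] by (rule order_tendstoD)
        then show ?thesis by eventually_elim simp
      next
        case False
        have "continuous_on UNIV (g i)"
          using g[OF i] unfolding gderiv_def
          by (meson has_derivative_continuous continuous_at_imp_continuous_on)
        then have "continuous_on UNIV (\<lambda>y. g i y - f y)" by (intro continuous_intros f)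
        then have "isCont (\<lambda>y. g i y - f y) x" by (simp add: continuous_on_eq_continuous_at)
        then have "((\<lambda>y. g i y - f y) \<longlongrightarrow> g i x - f x) (nhds x)"
          unfolding isCont_def by (rule tendsto_at_iff_tendsto_nhds[THEN iffD1])
        moreover have "g i x - f x \<noteq> 0" using False i A by simp
        ultimately have "eventually (\<lambda>y. g i y - f y \<noteq> 0) (nhds x)"
          by (rule tendsto_imp_eventually_ne)
        then show ?thesis by eventually_elim simp
      qed
    qed
    then have "eventually (\<lambda>y. \<forall>i\<in>I. g i y = f y \<longrightarrow> G i y \<bullet> v < - b) (nhds x)"
      by (rule eventually_ball_finite[OF assms(1)])
    then obtain \<delta> where \<delta>: "0 < \<delta>" "\<And>y i. dist y x < \<delta> \<Longrightarrow> i \<in> I \<Longrightarrow> g i y = f y \<Longrightarrow> G i y \<bullet> v < - b"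
      unfolding eventually_nhds_metric by blast
    have "eventually (\<lambda>y. dist y x < \<delta> / 2) (nhds x)"
      using \<delta>(1) by (intro eventually_nhds_metric[THEN iffD2]) (auto intro: exI[of _ "\<delta> / 2"])
    \<comment> \<open>With \<open>y\<close> within \<delta> / 2 of \<open>x\<close>, this bound on
      \<open>t\<close> keeps the segment from \<open>y\<close> to \<open>y + t *\<^sub>R v\<close>
      in the \<delta>-ball; the summand 1 avoids a zero denominator.\<close>
    moreover have "eventually (\<lambda>t. t \<in> {0<..<\<delta> / (2 * (norm v + 1))}) (at_right (0::real))"
      using \<delta>(1) by (intro eventually_at_right_real) (simp add: add_nonneg_pos)
    moreover have "ereal ((f (y + t *\<^sub>R v) - f y) / t) \<le> ereal (- b)"
      if y: "dist y x < \<delta> / 2" and t: "t \<in> {0<..<\<delta> / (2 * (norm v + 1))}" for y t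
    proof -
      have "f (y + t *\<^sub>R v) - f y \<le> - b * t"
      proof (rule selection_descent[OF assms(1) g f])
        fix i s assume i: "i \<in> I" and s: "0 \<le> s" "s \<le> t" and eq: "g i (y + s *\<^sub>R v) = f (y + s *\<^sub>R v)"
        have "s * norm v \<le> t * (norm v + 1)" using s t by (intro mult_mono) auto
        also have "\<dots> < \<delta> / 2"
        proof -
          have "0 < norm v + 1" by (simp add: add_nonneg_pos)
          then show ?thesis using t by (simp add: field_simps)
        qed
        finally have "dist (y + s *\<^sub>R v) y < \<delta> / 2" using s by (simp add: dist_norm)
        then have "dist (y + s *\<^sub>R v) x < \<delta>"
          using y dist_triangle[of "y + s *\<^sub>R v" x y] by linarith
        then show "G i (y + s *\<^sub>R v) \<bullet> v < - b" using \<delta>(2) i eq by blast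
      qed (use t in auto)
      then show ?thesis using t by (simp add: divide_le_eq)
    qed
    ultimately have "eventually (\<lambda>p. (case p of (y, t) \<Rightarrow> ereal ((f (y + t *\<^sub>R v) - f y) / t)) \<le> ereal (- b))
        (nhds x \<times>\<^sub>F at_right 0)"
      unfolding eventually_prod_filter case_prod_conv by blast
    then have "clarke_deriv f x v \<le> ereal (- b)" unfolding clarke_deriv_def by (rule Limsup_bounded)
    moreover have "0 \<le> clarke_deriv f x v"
      using crit by (auto simp: critical_point_def clarke_subdiff_def zero_ereal_def)
    ultimately have "0 \<le> ereal (- b)" by (rule order_trans[rotated])
    then show False using ab(1) by simp
  qed
  then obtain c where c: "\<And>z. z \<in> (\<lambda>i. G i x) ` A \<Longrightarrow> 0 \<le> c z" "sum c ((\<lambda>i. G i x) ` A) = 1"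
    "(\<Sum>z\<in>(\<lambda>i. G i x) ` A. c z *\<^sub>R z) = 0"
    using convex_hull_finite[of "(\<lambda>i. G i x) ` A"] finA by auto
  \<comment> \<open>Several active indices may share a gradient: \<open>R\<close> keeps one index
    per gradient, and the others get multiplier 0.\<close>
  obtain R where R: "R \<subseteq> A" "inj_on (\<lambda>i. G i x) R" "(\<lambda>i. G i x) ` A = (\<lambda>i. G i x) ` R"
    using subset_image_inj[of "(\<lambda>i. G i x) ` A" "\<lambda>i. G i x" A] by auto
  define \<mu> where "\<mu> = (\<lambda>i. if i \<in> R then c (G i x) else 0)"
  have "(\<Sum>i\<in>A. \<mu> i) = (\<Sum>i\<in>R. c (G i x))"
    unfolding \<mu>_def using finA R(1) by (simp add: sum.inter_restrict[symmetric] Int_absorb1)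
  moreover have "(\<Sum>i\<in>A. \<mu> i *\<^sub>R G i x) = (\<Sum>i\<in>R. c (G i x) *\<^sub>R G i x)"
    using finA R(1) by (intro sum.mono_neutral_cong_right) (auto simp: \<mu>_def)
  moreover have "0 \<le> \<mu> i" if "i \<in> A" for i using c(1) that by (simp add: \<mu>_def)
  ultimately show ?thesis
    using c(2,3) unfolding R(3) by (intro exI[of _ \<mu>]) (simp add: sum.reindex[OF R(2)] o_def)
qed

section \<open>The Karush-Kuhn-Tucker systems\<close>

lemma finite_multi_indices [simp]: "finite (multi_indices d :: ('n::finite \<Rightarrow> nat) set)"
proof (rule finite_subset)
  show "multi_indices d \<subseteq> PiE (UNIV :: 'n set) (\<lambda>_. {..d})"
  proof
    fix \<alpha> :: "'n \<Rightarrow> nat"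
    assume "\<alpha> \<in> multi_indices d"
    moreover have "\<alpha> j \<le> (\<Sum>j\<in>UNIV. \<alpha> j)" for j by (rule member_le_sum) auto
    ultimately have "\<alpha> j \<le> d" for j unfolding multi_indices_def using order_trans by blast
    then show "\<alpha> \<in> PiE UNIV (\<lambda>_. {..d})" by (simp add: PiE_iff)
  qed
qed (simp add: finite_PiE)

lemma finite_param_indices: "finite (param_indices d r)"
  by (simp add: param_indices_def)

text \<open>An explicit formula, polynomial in \<open>u\<close> and \<open>x\<close>, in place of
  the definite description in \<open>gradient\<close>. For \<open>\<alpha> j = 0\<close> the
  truncated exponent \<open>\<alpha> j - 1\<close> is harmless because the factor
  \<open>real (\<alpha> j)\<close> is 0.\<close>

definition poly_grad ::
  "nat \<Rightarrow> (nat \<times> ('n::finite \<Rightarrow> nat) \<Rightarrow> real) \<Rightarrow> nat \<Rightarrow> real^'n \<Rightarrow> real^'n" where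
  "poly_grad d u i x = (\<chi> j. \<Sum>\<alpha>\<in>multi_indices d.
     u (i, \<alpha>) * (real (\<alpha> j) * x $ j ^ (\<alpha> j - 1) * (\<Prod>l\<in>UNIV - {j}. x $ l ^ \<alpha> l)))"

lemma has_derivative_vec_nth: "((\<lambda>x. x $ j) has_derivative (\<lambda>h. h $ j)) F"
  by (rule bounded_linear_imp_has_derivative[OF bounded_linear_vec_nth])

lemma poly_fun_GDERIV: "GDERIV (poly_fun d u i) x :> poly_grad d u i x"
proof -
  have "((\<lambda>x. \<Prod>l\<in>UNIV. x $ l ^ \<alpha> l) has_derivative
      (\<lambda>h. \<Sum>j\<in>UNIV. h $ j * (real (\<alpha> j) * x $ j ^ (\<alpha> j - 1) * (\<Prod>l\<in>UNIV - {j}. x $ l ^ \<alpha> l)))) (at x)"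
    for \<alpha> :: "'a \<Rightarrow> nat"
  proof -
    have "((\<lambda>x. x $ l ^ \<alpha> l) has_derivative (\<lambda>h. real (\<alpha> l) * h $ l * x $ l ^ (\<alpha> l - 1))) (at x)" for l
      by (rule has_derivative_power[OF has_derivative_vec_nth])
    from has_derivative_prod[of UNIV "\<lambda>l x. x $ l ^ \<alpha> l", OF this]
    show ?thesis by (simp add: mult_ac)
  qed
  then have "((\<lambda>x. \<Sum>\<alpha>\<in>multi_indices d. u (i, \<alpha>) * (\<Prod>l\<in>UNIV. x $ l ^ \<alpha> l)) has_derivative
      (\<lambda>h. \<Sum>\<alpha>\<in>multi_indices d. u (i, \<alpha>) * (\<Sum>j\<in>UNIV. h $ j *
        (real (\<alpha> j) * x $ j ^ (\<alpha> j - 1) * (\<Prod>l\<in>UNIV - {j}. x $ l ^ \<alpha> l))))) (at x)"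
    by (intro has_derivative_sum has_derivative_mult_right)
  moreover have "(\<Sum>\<alpha>\<in>multi_indices d. u (i, \<alpha>) * (\<Sum>j\<in>UNIV. h $ j *
        (real (\<alpha> j) * x $ j ^ (\<alpha> j - 1) * (\<Prod>l\<in>UNIV - {j}. x $ l ^ \<alpha> l)))) = h \<bullet> poly_grad d u i x" for h
    unfolding inner_vec_def poly_grad_def
    by (simp add: sum_distrib_left mult_ac) (rule sum.swap)
  ultimately show ?thesis by (simp add: gderiv_def poly_fun_def[abs_def])
qed

lemma GDERIV_unique:
  assumes "GDERIV f x :> a" "GDERIV f x :> b"
  shows "a = b"
proof -
  have "(\<lambda>h. h \<bullet> a) = (\<lambda>h. h \<bullet> b)"
    using assms unfolding gderiv_def by (rule has_derivative_unique)
  then have "(a - b) \<bullet> a = (a - b) \<bullet> b" by meson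
  then have "(a - b) \<bullet> (a - b) = 0" by (simp add: inner_diff_right)
  then show ?thesis by simp
qed

lemma gradient_poly_fun: "gradient (poly_fun d u i) = poly_grad d u i"
  unfolding gradient_def
  by (intro ext the_equality poly_fun_GDERIV) (rule GDERIV_unique[OF _ poly_fun_GDERIV])

lemma poly_grad_differentiable:
  fixes x :: "real^'n"
  shows "poly_grad d u i differentiable (at x)"
proof -
  have pow: "(\<lambda>x :: real^'n. x $ j ^ k) differentiable (at x)" for j k x
    by (intro differentiable_power bounded_linear_imp_differentiable[OF bounded_linear_vec_nth])
  have prd: "(\<lambda>x :: real^'n. \<Prod>l\<in>A. x $ l ^ \<alpha> l) differentiable (at x)"
    for A :: "'n set" and \<alpha> x
  proof (induction A rule: infinite_finite_induct)
    case (insert a A)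
    then show ?case using differentiable_mult[OF pow] by simp
  qed simp_all
  show ?thesis
    by (rule differentiable_vec, unfold poly_grad_def vec_lambda_beta)
      (intro differentiable_sum ballI differentiable_mult pow prd differentiable_const
        finite_multi_indices)
qed

lemma poly_fun_deriv_line:
  "((\<lambda>t. poly_fun d u i (x + t *\<^sub>R y)) has_real_derivative poly_grad d u i x \<bullet> y) (at 0)"
proof -
  have "((\<lambda>s. x + s *\<^sub>R y) has_derivative (\<lambda>t. t *\<^sub>R y)) (at 0)"
    by (auto intro!: derivative_eq_intros)
  from has_derivative_compose[OF this, of "poly_fun d u i" "\<lambda>h. h \<bullet> poly_grad d u i x"]
    poly_fun_GDERIV[of d u i x]
  have "((\<lambda>t. poly_fun d u i (x + t *\<^sub>R y)) has_derivative (\<lambda>t. t *\<^sub>R y \<bullet> poly_grad d u i x)) (at 0)"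
    by (simp add: gderiv_def)
  then show ?thesis by (simp add: has_field_derivative_def inner_commute mult_commute_abs)
qed

lemma poly_grad_deriv_line:
  "((\<lambda>t. poly_grad d u i (x + t *\<^sub>R y) $ j) has_real_derivative (hessian (poly_fun d u i) x *v y) $ j) (at 0)"
proof -
  have 1: "((\<lambda>s. x + s *\<^sub>R y) has_derivative (\<lambda>t. t *\<^sub>R y)) (at 0)"
    by (auto intro!: derivative_eq_intros)
  have "(poly_grad d u i has_derivative (*v) (hessian (poly_fun d u i) x)) (at x)"
    using poly_grad_differentiable[of d u i x] unfolding hessian_def gradient_poly_fun
    by (rule jacobian_works[THEN iffD1])
  then have "((\<lambda>t. poly_grad d u i (x + t *\<^sub>R y)) has_derivative
      (\<lambda>t. hessian (poly_fun d u i) x *v (t *\<^sub>R y))) (at 0)"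
    using has_derivative_compose[OF 1, of "poly_grad d u i"] by simp
  then have "((\<lambda>t. poly_grad d u i (x + t *\<^sub>R y) $ j) has_derivative
      (\<lambda>t. (hessian (poly_fun d u i) x *v (t *\<^sub>R y)) $ j)) (at 0)"
    by (rule bounded_linear.has_derivative[OF bounded_linear_vec_nth])
  then show ?thesis
    by (simp add: has_field_derivative_def matrix_vector_mult_scaleR mult_commute_abs)
qed

lemma poly_fun_poly_funs:
  assumes "\<And>\<alpha>. \<alpha> \<in> multi_indices d \<Longrightarrow> (\<lambda>w. U w (i, \<alpha>)) \<in> poly_funs K"
    and "\<And>j. (\<lambda>w. X w $ j) \<in> poly_funs K"
  shows "(\<lambda>w. poly_fun d (U w) i (X w)) \<in> poly_funs K"
  unfolding poly_fun_def
  by (intro poly_funs_sum poly_funs.mult poly_funs_prod poly_funs_power assms)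

lemma poly_grad_poly_funs:
  assumes "\<And>\<alpha>. \<alpha> \<in> multi_indices d \<Longrightarrow> (\<lambda>w. U w (i, \<alpha>)) \<in> poly_funs K"
    and "\<And>j. (\<lambda>w. X w $ j) \<in> poly_funs K"
  shows "(\<lambda>w. poly_grad d (U w) i (X w) $ j) \<in> poly_funs K"
  unfolding poly_grad_def vec_lambda_beta
  by (intro poly_funs_sum poly_funs.mult poly_funs_prod poly_funs_power poly_funs.const assms)

text \<open>The multiplier of \<open>i0\<close> is normalised to 1, so \<mu> is read only on
  \<open>I - {i0}\<close>.\<close>

definition kkt_residual ::
  "nat \<Rightarrow> (nat \<times> ('n::finite \<Rightarrow> nat) \<Rightarrow> real) \<Rightarrow> nat set \<Rightarrow> nat \<Rightarrow> real^'n \<Rightarrow> (nat \<Rightarrow> real) \<Rightarrow> real^'n" where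
  "kkt_residual d u I i0 x \<mu> =
     poly_grad d u i0 x + (\<Sum>i\<in>I - {i0}. \<mu> i *\<^sub>R poly_grad d u i x)"

text \<open>For \<open>i0\<close> in a finite \<open>I\<close> this is a square system: the equation
  for \<open>i0\<close> itself is trivial, which leaves \<open>card I - 1\<close> equal values and
  one vector equation for \<open>x\<close> and \<open>card I - 1\<close> multipliers.\<close>

definition kkt_point ::
  "nat \<Rightarrow> (nat \<times> ('n::finite \<Rightarrow> nat) \<Rightarrow> real) \<Rightarrow> nat set \<Rightarrow> nat \<Rightarrow> real^'n \<Rightarrow> (nat \<Rightarrow> real) \<Rightarrow> bool" where
  "kkt_point d u I i0 x \<mu> \<longleftrightarrow>
     (\<forall>i\<in>I. poly_fun d u i x = poly_fun d u i0 x) \<and> kkt_residual d u I i0 x \<mu> = 0"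

text \<open>The pairs (y, \<nu>) form the kernel of the derivative of the system at (x, \<mu>).
  Derivatives along lines take the place of a block Jacobian matrix.\<close>

definition kkt_tangent ::
  "nat \<Rightarrow> (nat \<times> ('n::finite \<Rightarrow> nat) \<Rightarrow> real) \<Rightarrow> nat set \<Rightarrow> nat \<Rightarrow> real^'n \<Rightarrow> (nat \<Rightarrow> real) \<Rightarrow>
     real^'n \<Rightarrow> (nat \<Rightarrow> real) \<Rightarrow> bool" where
  "kkt_tangent d u I i0 x \<mu> y \<nu> \<longleftrightarrow>
     (\<forall>i\<in>I. ((\<lambda>t. poly_fun d u i0 (x + t *\<^sub>R y) - poly_fun d u i (x + t *\<^sub>R y)) has_real_derivative 0) (at 0)) \<and>
     (\<forall>j. ((\<lambda>t. kkt_residual d u I i0 (x + t *\<^sub>R y) (\<lambda>i. \<mu> i + t * \<nu> i) $ j) has_real_derivative 0) (at 0))"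

text \<open>Solving the system for the constant coefficients of \<open>f\<^sub>i\<close>, \<open>i \<in> I - {i\<^sub>0}\<close>, and the linear
  coefficients of \<open>f\<^bsub>i0\<^esub>\<close> parametrises the solutions \<open>(u, x, \<mu>)\<close> by a polynomial map \<open>\<phi>\<close>. Its argument
  has the same index set as \<open>u\<close>: the freed places hold \<open>\<mu>\<close> and \<open>x\<close>.\<close>

lemma kkt_parametrisation:
  fixes I :: "nat set" and d r :: nat
  assumes d: "1 \<le> d" and I: "I \<subseteq> {1..r}" and i0: "i0 \<in> I"
  obtains \<phi> enc and e :: "'n::finite \<Rightarrow> 'n \<Rightarrow> nat" where
    "\<And>p. p \<in> param_indices d r \<Longrightarrow> (\<lambda>w. \<phi> w p) \<in> poly_funs (param_indices d r)"
    "\<And>u x \<mu> j. enc u x \<mu> (i0, e j) = x $ j" "\<And>j. (i0, e j) \<in> param_indices d r"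
    "\<And>u x \<mu> i. i \<in> I - {i0} \<Longrightarrow> enc u x \<mu> (i, \<lambda>_. 0) = \<mu> i"
    "\<And>i. i \<in> I \<Longrightarrow> (i, \<lambda>_ :: 'n. 0) \<in> param_indices d r"
    "\<And>u x \<mu> y \<nu> t p. enc u (x + t *\<^sub>R y) (\<lambda>i. \<mu> i + t * \<nu> i) p = enc u x \<mu> p + t * enc (\<lambda>_. 0) y \<nu> p"
    "\<And>u x \<mu>. kkt_point d u I i0 x \<mu> \<Longrightarrow> \<phi> (enc u x \<mu>) = u"
    "\<And>u x \<mu> y \<nu> p. kkt_point d u I i0 x \<mu> \<Longrightarrow> kkt_tangent d u I i0 x \<mu> y \<nu> \<Longrightarrow>
       ((\<lambda>t. \<phi> (enc u (x + t *\<^sub>R y) (\<lambda>i. \<mu> i + t * \<nu> i)) p) has_real_derivative 0) (at 0)"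
proof -
  \<comment> \<open>\<open>e j\<close> is the exponent of the linear monomial \<open>x $ j\<close>,
    and \<open>z\<close> that of the constant monomial.\<close>
  define e where "e = (\<lambda>j l :: 'n. if l = j then 1 else (0::nat))"
  define z where "z = (\<lambda>_ :: 'n. 0 :: nat)"
  have e_inj: "e j = e l \<longleftrightarrow> j = l" for j l by (auto simp: e_def fun_eq_iff)
  have e_z: "e j \<noteq> z" "z \<noteq> e j" for j by (auto simp: e_def z_def fun_eq_iff)
  have e_mi: "e j \<in> multi_indices d" for j using d by (simp add: multi_indices_def e_def)
  have z_mi: "z \<in> multi_indices d" by (simp add: multi_indices_def z_def)
  have J: "(i0, e j) \<in> param_indices d r" "i \<in> I \<Longrightarrow> (i, z) \<in> param_indices d r" for i j
    using I i0 e_mi z_mi by (auto simp: param_indices_def)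
  define S where "S = range (\<lambda>j. (i0, e j)) \<union> (\<lambda>i. (i, z)) ` (I - {i0})"
  \<comment> \<open>\<open>merge\<close> writes \<open>x\<close> into the linear places of piece
    \<open>i0\<close> and \<mu> into the constant places of the other pieces in \<open>I\<close>.
    The sum over \<open>j\<close> picks the coordinate belonging to \<open>p\<close> without
    inverting \<open>e\<close>.\<close>
  define merge :: "(nat \<times> ('n \<Rightarrow> nat) \<Rightarrow> real) \<Rightarrow> real^'n \<Rightarrow> (nat \<Rightarrow> real) \<Rightarrow> nat \<times> ('n \<Rightarrow> nat) \<Rightarrow> real"
    where "merge = (\<lambda>u x \<mu> p. if p \<in> range (\<lambda>j. (i0, e j)) then \<Sum>j\<in>UNIV. (if p = (i0, e j) then x $ j else 0)
      else if p \<in> (\<lambda>i. (i, z)) ` (I - {i0}) then \<mu> (fst p) else u p)"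
  have merge1: "merge u x \<mu> (i0, e j) = x $ j" for u x \<mu> j
    by (simp add: merge_def e_inj)
  have merge2: "merge u x \<mu> (i, z) = \<mu> i" if "i \<in> I - {i0}" for u x \<mu> i
    using that e_z by (auto simp: merge_def)
  have merge3: "merge u x \<mu> p = u p" if "p \<notin> S" for u x \<mu> p
    using that by (auto simp: merge_def S_def)
  have casesp: "thesis" if "\<And>j. p = (i0, e j) \<Longrightarrow> thesis" "\<And>i. i \<in> I - {i0} \<Longrightarrow> p = (i, z) \<Longrightarrow> thesis"
    "p \<notin> S \<Longrightarrow> thesis" for p thesis
    using that unfolding S_def by blast
  define X :: "(nat \<times> ('n \<Rightarrow> nat) \<Rightarrow> real) \<Rightarrow> real^'n" where "X = (\<lambda>w. \<chi> j. w (i0, e j))"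
  \<comment> \<open>\<open>V\<close> sets the freed coefficients to 0. Then \<open>a\<close> holds
    the linear coefficients that cancel the residual, and \<open>b\<close> the constant coefficients
    that make the values agree with that of piece \<open>i0\<close>.\<close>
  define V where "V = (\<lambda>w :: nat \<times> ('n \<Rightarrow> nat) \<Rightarrow> real. merge w 0 (\<lambda>_. 0))"
  define a where "a = (\<lambda>w. - kkt_residual d (V w) I i0 (X w) (\<lambda>i. w (i, z)))"
  define b where "b = (\<lambda>w i. poly_fun d (V w) i0 (X w) + a w \<bullet> X w - poly_fun d (V w) i (X w))"
  define \<phi> where "\<phi> = (\<lambda>w. merge w (a w) (b w))"
  have V_poly: "(\<lambda>w. V w p) \<in> poly_funs (param_indices d r)" if "p \<in> param_indices d r" for p
    by (rule casesp[of p]) (auto simp: V_def merge1 merge2 merge3 poly_funs.const poly_funs.coord that)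
  have mi: "(i, \<alpha>) \<in> param_indices d r" if "i \<in> I" "\<alpha> \<in> multi_indices d" for i and \<alpha> :: "'n \<Rightarrow> nat"
    using that I by (auto simp: param_indices_def)
  have X_poly: "(\<lambda>w. X w $ j) \<in> poly_funs (param_indices d r)" for j
    unfolding X_def vec_lambda_beta by (intro poly_funs.coord J)
  have f_poly: "(\<lambda>w. poly_fun d (V w) i (X w)) \<in> poly_funs (param_indices d r)" if "i \<in> I" for i
    by (intro poly_fun_poly_funs V_poly X_poly mi that)
  have a_poly: "(\<lambda>w. a w $ j) \<in> poly_funs (param_indices d r)" for j
    unfolding a_def kkt_residual_def vector_uminus_component vector_add_component sum_component
      vector_scaleR_component real_scaleR_def
    by (intro poly_funs_uminus poly_funs.add poly_funs_sum poly_funs.mult poly_grad_poly_funs V_poly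
        X_poly mi poly_funs.coord J i0) auto
  have \<phi>_poly: "(\<lambda>w. \<phi> w p) \<in> poly_funs (param_indices d r)" if p: "p \<in> param_indices d r" for p
  proof (rule casesp[of p])
    fix i assume i: "i \<in> I - {i0}" "p = (i, z)"
    then show ?thesis unfolding \<phi>_def i(2) merge2[OF i(1)] b_def inner_vec_def inner_real_def
      by (intro poly_funs_diff poly_funs.add poly_funs_sum poly_funs.mult f_poly a_poly X_poly i0) auto
  qed (auto simp: \<phi>_def merge1 merge3 a_poly p poly_funs.coord)

  have f0: "poly_fun d u i0 x = poly_fun d (V u) i0 x + X u \<bullet> x" for u x
  proof -
    have "poly_fun d u i0 x - poly_fun d (V u) i0 x
      = (\<Sum>\<alpha>\<in>multi_indices d. (u (i0, \<alpha>) - V u (i0, \<alpha>)) * (\<Prod>l\<in>UNIV. x $ l ^ \<alpha> l))"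
      by (simp add: poly_fun_def sum_subtractf left_diff_distrib)
    also have "\<dots> = (\<Sum>\<alpha>\<in>multi_indices d. \<Sum>j\<in>UNIV. (if \<alpha> = e j then X u $ j * x $ j else 0))"
    proof (rule sum.cong)
      fix \<alpha> :: "'n \<Rightarrow> nat"
      show "(u (i0, \<alpha>) - V u (i0, \<alpha>)) * (\<Prod>l\<in>UNIV. x $ l ^ \<alpha> l)
        = (\<Sum>j\<in>UNIV. (if \<alpha> = e j then X u $ j * x $ j else 0))"
      proof (cases "\<exists>j. \<alpha> = e j")
        case True
        then obtain j where \<alpha>: "\<alpha> = e j" by blast
        have "(\<Prod>l\<in>UNIV. x $ l ^ e j l) = (\<Prod>l\<in>UNIV. if l = j then x $ l else 1)"
          by (rule prod.cong) (auto simp: e_def)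
        then show ?thesis by (simp add: \<alpha> V_def merge1 e_inj X_def)
      next
        case False
        then have "(i0, \<alpha>) \<notin> S" by (auto simp: S_def)
        then show ?thesis using False by (simp add: V_def merge3)
      qed
    qed simp
    also have "\<dots> = X u \<bullet> x"
      unfolding inner_vec_def inner_real_def
      by (subst sum.swap) (simp add: e_mi)
    finally show ?thesis by simp
  qed
  have fi: "poly_fun d u i x = poly_fun d (V u) i x + u (i, z)" if i: "i \<in> I - {i0}" for u x i
  proof -
    have "poly_fun d u i x - poly_fun d (V u) i x
      = (\<Sum>\<alpha>\<in>multi_indices d. (u (i, \<alpha>) - V u (i, \<alpha>)) * (\<Prod>l\<in>UNIV. x $ l ^ \<alpha> l))"
      by (simp add: poly_fun_def sum_subtractf left_diff_distrib)
    also have "\<dots> = (\<Sum>\<alpha>\<in>multi_indices d. if \<alpha> = z then u (i, z) else 0)"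
    proof (rule sum.cong)
      fix \<alpha> :: "'n \<Rightarrow> nat"
      show "(u (i, \<alpha>) - V u (i, \<alpha>)) * (\<Prod>l\<in>UNIV. x $ l ^ \<alpha> l) = (if \<alpha> = z then u (i, z) else 0)"
      proof (cases "\<alpha> = z")
        case True
        have "V u (i, z) = 0" unfolding V_def using merge2[OF i] by simp
        then show ?thesis using True by (simp add: z_def)
      next
        case False
        then have "(i, \<alpha>) \<notin> S" using i by (auto simp: S_def)
        then show ?thesis using False by (simp add: V_def merge3)
      qed
    qed simp
    also have "\<dots> = u (i, z)" by (simp add: z_mi)
    finally show ?thesis by simp
  qed
  have g0: "poly_grad d u i0 x = poly_grad d (V u) i0 x + X u" for u x
  proof (rule GDERIV_unique[OF poly_fun_GDERIV])
    have "GDERIV (\<lambda>x. X u \<bullet> x) x :> X u"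
      unfolding gderiv_def by (auto intro!: derivative_eq_intros simp: inner_commute)
    moreover have "poly_fun d u i0 = (\<lambda>x. poly_fun d (V u) i0 x + X u \<bullet> x)" using f0 by blast
    ultimately show "GDERIV (poly_fun d u i0) x :> poly_grad d (V u) i0 x + X u"
      using GDERIV_add[OF poly_fun_GDERIV] by simp
  qed
  have gi: "poly_grad d u i x = poly_grad d (V u) i x" if i: "i \<in> I - {i0}" for u x i
  proof (rule GDERIV_unique[OF poly_fun_GDERIV])
    have "poly_fun d u i = (\<lambda>x. poly_fun d (V u) i x + u (i, z))" using fi[OF i] by blast
    then show "GDERIV (poly_fun d u i) x :> poly_grad d (V u) i x"
      using GDERIV_add[OF poly_fun_GDERIV GDERIV_const] by simp
  qed
  have res: "kkt_residual d u I i0 x \<mu> = kkt_residual d (V u) I i0 x \<mu> + X u" for u x \<mu>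
    by (simp add: kkt_residual_def g0[of u] gi[of _ u])
  have V_merge: "V (merge u x \<mu>) = V u" for u x \<mu>
  proof
    fix p show "V (merge u x \<mu>) p = V u p"
      by (rule casesp[of p]) (auto simp: V_def merge1 merge2 merge3)
  qed
  have X_merge: "X (merge u x \<mu>) = x" for u x \<mu> by (simp add: X_def merge1)
  have resm: "kkt_residual d v I i0 x (\<lambda>i. merge u x' \<mu> (i, z)) = kkt_residual d v I i0 x \<mu>" for u v x' \<mu> and x :: "real^'n"
    by (simp add: kkt_residual_def merge2)
  \<comment> \<open>For arbitrary data the recovered coefficients differ from the true ones by terms
    built from the errors of the system. Hence they are exact at solutions and stationary there
    along tangent directions.\<close>
  have am: "a (merge u x \<mu>) = X u - kkt_residual d u I i0 x \<mu>" for u x \<mu>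
    unfolding a_def V_merge X_merge resm res[of u] by simp
  have bm: "b (merge u x \<mu>) i = u (i, z) + (poly_fun d u i0 x - poly_fun d u i x) - kkt_residual d u I i0 x \<mu> \<bullet> x"
    if "i \<in> I - {i0}" for u x \<mu> i
    unfolding b_def V_merge X_merge am f0[of u] fi[OF that, of u] by (simp add: inner_diff_left)
  show thesis
  proof (rule that[of \<phi> merge e, folded z_def])
    show "(\<lambda>w. \<phi> w p) \<in> poly_funs (param_indices d r)" if "p \<in> param_indices d r" for p
      by (rule \<phi>_poly[OF that])
    show "merge u (x + t *\<^sub>R y) (\<lambda>i. \<mu> i + t * \<nu> i) p = merge u x \<mu> p + t * merge (\<lambda>_. 0) y \<nu> p"
      for u x \<mu> y \<nu> t p
      by (rule casesp[of p]) (auto simp: merge1 merge2 merge3)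
    show "\<phi> (merge u x \<mu>) = u" if k: "kkt_point d u I i0 x \<mu>" for u x \<mu>
    proof
      fix p show "\<phi> (merge u x \<mu>) p = u p"
      proof (rule casesp[of p])
        fix j assume "p = (i0, e j)"
        then show ?thesis using k by (simp add: \<phi>_def merge1 am kkt_point_def X_def)
      next
        fix i assume "i \<in> I - {i0}" "p = (i, z)"
        then show ?thesis using k by (simp add: \<phi>_def merge2 bm kkt_point_def)
      qed (simp add: \<phi>_def merge3)
    qed
    show "((\<lambda>t. \<phi> (merge u (x + t *\<^sub>R y) (\<lambda>i. \<mu> i + t * \<nu> i)) p) has_real_derivative 0) (at 0)"
      if k: "kkt_point d u I i0 x \<mu>" and tan: "kkt_tangent d u I i0 x \<mu> y \<nu>" for u x \<mu> y \<nu> p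
    proof -
      let ?R = "\<lambda>t. kkt_residual d u I i0 (x + t *\<^sub>R y) (\<lambda>i. \<mu> i + t * \<nu> i)"
      have dR: "((\<lambda>t. ?R t $ j) has_real_derivative 0) (at 0)" for j
        using tan by (simp add: kkt_tangent_def)
      have R0: "?R 0 $ j = 0" for j using k by (simp add: kkt_point_def)
      show ?thesis
      proof (rule casesp[of p])
        fix j assume "p = (i0, e j)"
        then show ?thesis using DERIV_diff[OF DERIV_const dR] by (simp add: \<phi>_def merge1 am)
      next
        fix i assume i: "i \<in> I - {i0}" "p = (i, z)"
        \<comment> \<open>\<open>?R\<close> and its derivative both vanish at 0, so every product
          with a coordinate of \<open>x + t *\<^sub>R y\<close> is stationary.\<close>
        have "((\<lambda>t. \<Sum>j\<in>UNIV. ?R t $ j * (x $ j + t * y $ j)) has_real_derivative (\<Sum>j::'n\<in>UNIV. 0)) (at 0)"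
        proof (rule DERIV_sum)
          fix j
          have "((\<lambda>t. x $ j + t * y $ j) has_real_derivative y $ j) (at 0)"
            by (auto intro!: derivative_eq_intros)
          from DERIV_mult[OF dR this] show "((\<lambda>t. ?R t $ j * (x $ j + t * y $ j)) has_real_derivative 0) (at 0)"
            using R0 by simp
        qed
        then have 1: "((\<lambda>t. ?R t \<bullet> (x + t *\<^sub>R y)) has_real_derivative 0) (at 0)"
          by (simp add: inner_vec_def)
        have 2: "((\<lambda>t. poly_fun d u i0 (x + t *\<^sub>R y) - poly_fun d u i (x + t *\<^sub>R y)) has_real_derivative 0) (at 0)"
          using tan i by (simp add: kkt_tangent_def)
        from DERIV_diff[OF DERIV_add[OF DERIV_const 2] 1] show ?thesis
          using i by (simp add: \<phi>_def merge2 bm)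
      next
        assume "p \<notin> S" then show ?thesis by (simp add: \<phi>_def merge3)
      qed
    qed
  qed (auto simp: merge1 merge2 J)
qed

text \<open>The polynomial is a product over all places \<open>p\<close>: the factor
  \<open>P p\<close> excludes solutions with a kernel direction that is nonzero at \<open>p\<close>,
  and \<open>Q p\<close> excludes the image of the hyperplane \<open>w p = 0\<close>, hence zero
  multipliers.\<close>

lemma generic_kkt_points:
  fixes I :: "nat set" and d r :: nat
  assumes d: "1 \<le> d" and I: "I \<subseteq> {1..r}" and i0: "i0 \<in> I"
  shows "\<exists>P\<in>poly_funs (param_indices d r :: (nat \<times> ('n::finite \<Rightarrow> nat)) set). (\<exists>u. P u \<noteq> 0) \<and>
    (\<forall>u x \<mu>. P u \<noteq> 0 \<longrightarrow> kkt_point d u I i0 x \<mu> \<longrightarrow>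
      (\<forall>i\<in>I - {i0}. \<mu> i \<noteq> 0) \<and>
      (\<forall>y \<nu>. kkt_tangent d u I i0 x \<mu> y \<nu> \<longrightarrow> y = 0 \<and> (\<forall>i\<in>I - {i0}. \<nu> i = 0)))"
proof -
  let ?J = "param_indices d r :: (nat \<times> ('n \<Rightarrow> nat)) set"
  obtain \<phi> enc and e :: "'n \<Rightarrow> 'n \<Rightarrow> nat" where
    poly: "\<And>p. p \<in> ?J \<Longrightarrow> (\<lambda>w. \<phi> w p) \<in> poly_funs ?J" and
    enc: "\<And>u x \<mu> j. enc u x \<mu> (i0, e j) = x $ j" "\<And>j. (i0, e j) \<in> ?J"
    "\<And>u x \<mu> i. i \<in> I - {i0} \<Longrightarrow> enc u x \<mu> (i, \<lambda>_. 0) = \<mu> i"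
    "\<And>i. i \<in> I \<Longrightarrow> (i, \<lambda>_. 0) \<in> ?J" and
    lin: "\<And>u x \<mu> y \<nu> t p. enc u (x + t *\<^sub>R y) (\<lambda>i. \<mu> i + t * \<nu> i) p = enc u x \<mu> p + t * enc (\<lambda>_. 0) y \<nu> p" and
    sol: "\<And>u x \<mu>. kkt_point d u I i0 x \<mu> \<Longrightarrow> \<phi> (enc u x \<mu>) = u" and
    tan: "\<And>u x \<mu> y \<nu> p. kkt_point d u I i0 x \<mu> \<Longrightarrow> kkt_tangent d u I i0 x \<mu> y \<nu> \<Longrightarrow>
       ((\<lambda>t. \<phi> (enc u (x + t *\<^sub>R y) (\<lambda>i. \<mu> i + t * \<nu> i)) p) has_real_derivative 0) (at 0)"
    by (rule kkt_parametrisation[OF d I i0, where 'n = 'n]) blast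
  have fin: "finite ?J" by (rule finite_param_indices)
  define crit where "crit = (\<lambda>w v. \<forall>i\<in>?J.
    ((\<lambda>t. \<phi> (\<lambda>l. w l + t * v l) i) has_real_derivative 0) (at 0))"
  have "\<forall>p\<in>?J. \<exists>P\<in>poly_funs ?J. (\<exists>u. P u \<noteq> 0) \<and>
    (\<forall>w v. crit w v \<longrightarrow> v p \<noteq> 0 \<longrightarrow> P (\<phi> w) = 0)"
  proof
    fix p assume p: "p \<in> ?J"
    show "\<exists>P\<in>poly_funs ?J. (\<exists>u. P u \<noteq> 0) \<and> (\<forall>w v. crit w v \<longrightarrow> v p \<noteq> 0 \<longrightarrow> P (\<phi> w) = 0)"
      unfolding crit_def
      by (rule critical_values_hypersurface[where \<phi> = \<phi> and j = p, OF fin])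
        (rule poly p, assumption?)+
  qed
  then obtain P where P: "\<And>p. p \<in> ?J \<Longrightarrow> P p \<in> poly_funs ?J" "\<And>p. p \<in> ?J \<Longrightarrow> \<exists>u. P p u \<noteq> 0"
    "\<And>p w v. p \<in> ?J \<Longrightarrow> crit w v \<Longrightarrow> v p \<noteq> 0 \<Longrightarrow> P p (\<phi> w) = 0" by metis
  have "\<forall>p\<in>?J. \<exists>Q\<in>poly_funs ?J. (\<exists>u. Q u \<noteq> 0) \<and> (\<forall>w. w p = 0 \<longrightarrow> Q (\<phi> w) = 0)"
  proof
    fix p assume "p \<in> ?J"
    then have coord: "(\<lambda>w. w p) \<in> poly_funs ?J" by (rule poly_funs.coord)
    show "\<exists>Q\<in>poly_funs ?J. (\<exists>u. Q u \<noteq> 0) \<and> (\<forall>w. w p = 0 \<longrightarrow> Q (\<phi> w) = 0)"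
      by (rule image_of_hypersurface[where \<phi> = \<phi> and h = "\<lambda>w. w p" and a = "\<lambda>_. 1",
            OF fin poly coord]) simp_all
  qed
  then obtain Q where Q: "\<And>p. p \<in> ?J \<Longrightarrow> Q p \<in> poly_funs ?J" "\<And>p. p \<in> ?J \<Longrightarrow> \<exists>u. Q p u \<noteq> 0"
    "\<And>p w. p \<in> ?J \<Longrightarrow> w p = 0 \<Longrightarrow> Q p (\<phi> w) = 0" by metis
  define R where "R = (\<lambda>u. (\<Prod>p\<in>?J. P p u) * (\<Prod>p\<in>?J. Q p u))"
  have pp: "(\<lambda>u. \<Prod>p\<in>?J. P p u) \<in> poly_funs ?J" "(\<lambda>u. \<Prod>p\<in>?J. Q p u) \<in> poly_funs ?J"
    by (rule poly_funs_prod, erule P) (rule poly_funs_prod, erule Q)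
  have "\<exists>u. R u \<noteq> 0"
  proof -
    have "\<exists>a. (\<Prod>p\<in>?J. P p a) \<noteq> 0"
      by (rule poly_funs_prod_nonzero[OF fin, where p = P and J = ?J]) (erule P)+
    moreover have "\<exists>a. (\<Prod>p\<in>?J. Q p a) \<noteq> 0"
      by (rule poly_funs_prod_nonzero[OF fin, where p = Q and J = ?J]) (erule Q)+
    ultimately obtain a b where ab: "(\<Prod>p\<in>?J. P p a) \<noteq> 0" "(\<Prod>p\<in>?J. Q p b) \<noteq> 0" by blast
    show ?thesis
    proof (rule ccontr)
      assume "\<not> ?thesis"
      then have zero: "(\<Prod>p\<in>?J. P p w) * (\<Prod>p\<in>?J. Q p w) = 0" for w unfolding R_def by blast
      have "(\<Prod>p\<in>?J. Q p b) = 0"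
        by (rule poly_funs_mult_eq_0[where p = "\<lambda>u. \<Prod>p\<in>?J. P p u" and q = "\<lambda>u. \<Prod>p\<in>?J. Q p u"])
          (rule pp zero ab)+
      then show False using ab(2) by simp
    qed
  qed
  moreover have "R \<in> poly_funs ?J" unfolding R_def by (intro poly_funs.mult pp)
  moreover have "(\<forall>i\<in>I - {i0}. \<mu> i \<noteq> 0) \<and>
      (\<forall>y \<nu>. kkt_tangent d u I i0 x \<mu> y \<nu> \<longrightarrow> y = 0 \<and> (\<forall>i\<in>I - {i0}. \<nu> i = 0))"
    if R: "R u \<noteq> 0" and k: "kkt_point d u I i0 x \<mu>" for u x \<mu>
  proof -
    have nz: "P p u \<noteq> 0" "Q p u \<noteq> 0" if "p \<in> ?J" for p
      using R that fin by (auto simp: R_def)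
    have "\<mu> i \<noteq> 0" if i: "i \<in> I - {i0}" for i
    proof
      assume "\<mu> i = 0"
      then have "enc u x \<mu> (i, \<lambda>_. 0) = 0" using enc(3)[OF i] by simp
      then show False using Q(3)[of "(i, \<lambda>_. 0)" "enc u x \<mu>"] nz(2) enc(4) i sol[OF k] by auto
    qed
    moreover have "y = 0 \<and> (\<forall>i\<in>I - {i0}. \<nu> i = 0)" if t: "kkt_tangent d u I i0 x \<mu> y \<nu>" for y \<nu>
    proof -
      have v: "enc (\<lambda>_. 0) y \<nu> p = 0" if p: "p \<in> ?J" for p
      proof (rule ccontr)
        assume nz': "enc (\<lambda>_. 0) y \<nu> p \<noteq> 0"
        \<comment> \<open>The encoding is affine, so moving (x, \<mu>) along (y, \<nu>) traces a
          line in the domain of \<phi>.\<close>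
        have eq: "(\<lambda>l. enc u x \<mu> l + s * enc (\<lambda>_. 0) y \<nu> l)
            = enc u (x + s *\<^sub>R y) (\<lambda>i. \<mu> i + s * \<nu> i)" for s
          by (rule ext) (rule lin[symmetric])
        have "crit (enc u x \<mu>) (enc (\<lambda>_. 0) y \<nu>)"
          unfolding crit_def eq by (intro ballI tan[OF k t])
        from P(3)[OF p this nz'] have "P p (\<phi> (enc u x \<mu>)) = 0" .
        then show False using nz(1)[OF p] sol[OF k] by simp
      qed
      have "y $ j = 0" for j using v[OF enc(2)[of j]] enc(1) by simp
      moreover have "\<nu> i = 0" if "i \<in> I - {i0}" for i
        using v[OF enc(4)[of i]] enc(3)[OF that] that by simp
      ultimately show ?thesis by (simp add: vec_eq_iff)
    qed
    ultimately show ?thesis by blast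
  qed
  ultimately show ?thesis by blast
qed

section \<open>Counting the solutions for one index set\<close>

lemma poly_fun_pdeg:
  fixes X :: "('j \<Rightarrow> real) \<Rightarrow> real^'n"
  assumes "\<And>j. pdeg K 1 (\<lambda>w. X w $ j)"
  shows "pdeg K d (\<lambda>w. poly_fun d u i (X w))"
  unfolding poly_fun_def
proof (rule pdeg_sum)
  fix \<alpha> :: "'n \<Rightarrow> nat" assume \<alpha>: "\<alpha> \<in> multi_indices d"
  have "pdeg K (0 + (\<Sum>j\<in>UNIV. \<alpha> j * 1)) (\<lambda>w. u (i, \<alpha>) * (\<Prod>j\<in>UNIV. X w $ j ^ \<alpha> j))"
    by (intro pdeg_mult pdeg.const pdeg_prod pdeg_power assms)
  then show "pdeg K d (\<lambda>w. u (i, \<alpha>) * (\<Prod>j\<in>UNIV. X w $ j ^ \<alpha> j))"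
    by (rule pdeg_mono) (use \<alpha> in \<open>simp add: multi_indices_def\<close>)
qed

lemma poly_grad_pdeg:
  fixes X :: "('j \<Rightarrow> real) \<Rightarrow> real^'n"
  assumes "\<And>j. pdeg K 1 (\<lambda>w. X w $ j)"
  shows "pdeg K (d - 1) (\<lambda>w. poly_grad d u i (X w) $ j)"
  unfolding poly_grad_def vec_lambda_beta
proof (rule pdeg_sum)
  fix \<alpha> :: "'n \<Rightarrow> nat" assume \<alpha>: "\<alpha> \<in> multi_indices d"
  let ?t = "\<lambda>w. u (i, \<alpha>) * (real (\<alpha> j) * X w $ j ^ (\<alpha> j - 1) * (\<Prod>l\<in>UNIV - {j}. X w $ l ^ \<alpha> l))"
  show "pdeg K (d - 1) ?t"
  proof (cases "\<alpha> j = 0")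
    case True
    then show ?thesis by (simp add: pdeg.const)
  next
    case False
    have "pdeg K (0 + (0 + (\<alpha> j - 1) * 1 + (\<Sum>l\<in>UNIV - {j}. \<alpha> l * 1))) ?t"
      by (intro pdeg_mult pdeg.const pdeg_prod pdeg_power assms)
    moreover have "\<alpha> j + (\<Sum>l\<in>UNIV - {j}. \<alpha> l) \<le> d"
      using \<alpha> by (simp add: multi_indices_def sum.remove[of UNIV j])
    ultimately show ?thesis using False by (elim pdeg_mono) simp
  qed
qed

text \<open>The unknowns are placed in two copies of \<open>'n\<close>: the first holds
  \<open>x\<close>, the second the multipliers, embedded by \<sigma>. Each genuine equation
  contributes a factor \<open>d + 1\<close>; each surplus coordinate is forced to 0 by an equation
  of degree 1 and contributes a factor 1.\<close>

lemma card_kkt_points: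
  fixes u :: "nat \<times> ('n::finite \<Rightarrow> nat) \<Rightarrow> real"
  assumes d: "1 \<le> d" and I: "finite I" "i0 \<in> I"
    and reg: "\<And>x \<mu> y \<nu>. kkt_point d u I i0 x \<mu> \<Longrightarrow> kkt_tangent d u I i0 x \<mu> y \<nu> \<Longrightarrow>
      y = 0 \<and> (\<forall>i\<in>I - {i0}. \<nu> i = 0)"
  shows "finite {x. \<exists>\<mu>. kkt_point d u I i0 x \<mu>} \<and>
    card {x. \<exists>\<mu>. kkt_point d u I i0 x \<mu>} \<le> (d + 1) ^ (CARD('n) - 1 + card I)"
proof (cases "\<exists>x \<mu>. kkt_point d u I i0 x \<mu>")
  case False
  then show ?thesis by simp
next
  case True
  then obtain x1 \<mu>1 where k1: "kkt_point d u I i0 x1 \<mu>1" by blast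
  define A where "A = I - {i0}"
  have finA: "finite A" and cardI: "card I = Suc (card A)" using I card.remove[OF I] by (simp_all add: A_def)
  \<comment> \<open>More multipliers than coordinates would make the gradients linearly dependent,
    and a dependency \<nu> would give a nonzero kernel element (0, \<nu>), against
    regularity.\<close>
  have "card A \<le> CARD('n)"
  proof (rule ccontr)
    assume "\<not> ?thesis"
    then have "card (UNIV :: 'n set) < card A" by simp
    from underdetermined_system[OF finite finA this, of "\<lambda>i j. poly_grad d u i x1 $ j"]
    obtain \<nu> where \<nu>: "\<exists>i\<in>A. \<nu> i \<noteq> 0" "\<And>j. (\<Sum>i\<in>A. \<nu> i * poly_grad d u i x1 $ j) = 0" by blast
    have "kkt_residual d u I i0 x1 (\<lambda>i. \<mu>1 i + t * \<nu> i) $ j = kkt_residual d u I i0 x1 \<mu>1 $ j" for t j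
    proof -
      have "(\<Sum>i\<in>A. t * (\<nu> i * poly_grad d u i x1 $ j)) = 0"
        using \<nu>(2)[of j] by (simp add: sum_distrib_left[symmetric])
      then show ?thesis
        by (simp add: kkt_residual_def A_def[symmetric] distrib_right sum.distrib mult.assoc)
    qed
    then have "kkt_tangent d u I i0 x1 \<mu>1 0 \<nu>" by (simp add: kkt_tangent_def)
    from reg[OF k1 this] \<nu>(1) show False by (auto simp: A_def)
  qed
  then obtain \<sigma> :: "nat \<Rightarrow> 'n" where \<sigma>: "inj_on \<sigma> A" using card_le_inj[OF finA, of "UNIV :: 'n set"] by auto
  define \<tau> where "\<tau> = inv_into A \<sigma>"
  have \<tau>: "\<tau> (\<sigma> i) = i" if "i \<in> A" for i using \<sigma> that by (simp add: \<tau>_def)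
  define X :: "('n + 'n \<Rightarrow> real) \<Rightarrow> real^'n" where "X = (\<lambda>w. \<chi> j. w (Inl j))"
  define M :: "('n + 'n \<Rightarrow> real) \<Rightarrow> nat \<Rightarrow> real" where "M = (\<lambda>w i. w (Inr (\<sigma> i)))"
  define L where "L = (\<lambda>k w. case k of Inl j \<Rightarrow> kkt_residual d u I i0 (X w) (M w) $ j
    | Inr l \<Rightarrow> if l \<in> \<sigma> ` A then poly_fun d u i0 (X w) - poly_fun d u (\<tau> l) (X w) else 0)"
  \<comment> \<open>Genuine equations have \<open>c k = 0\<close> and \<open>D k = d + 1\<close>, so
    they consist of \<open>L k\<close> alone; surplus coordinates have \<open>c k = 1\<close>,
    \<open>D k = 1\<close> and \<open>L k\<close> zero.\<close>
  define c where "c = (\<lambda>k :: 'n + 'n. case k of Inl j \<Rightarrow> 0 | Inr l \<Rightarrow> if l \<in> \<sigma> ` A then 0 else (1::real))"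
  define D where "D = (\<lambda>k :: 'n + 'n. case k of Inl j \<Rightarrow> d + 1 | Inr l \<Rightarrow> if l \<in> \<sigma> ` A then d + 1 else 1)"
  define F :: "real^('n + 'n) \<Rightarrow> real^('n + 'n)" where
    "F = (\<lambda>z. \<chi> k. c k * (z $ k) ^ D k + L k (vec_nth z))"
  have X1: "pdeg UNIV 1 (\<lambda>w. X w $ j)" for j
    unfolding X_def vec_lambda_beta One_nat_def by (rule pdeg_coord) simp
  have degL: "pdeg UNIV (D k - 1) (L k)" for k
  proof (cases k)
    case (Inl j)
    have "pdeg UNIV d (\<lambda>w. kkt_residual d u I i0 (X w) (M w) $ j)"
      unfolding kkt_residual_def vector_add_component sum_component vector_scaleR_component real_scaleR_def
    proof (rule pdeg.add)
      show "pdeg UNIV d (\<lambda>w. poly_grad d u i0 (X w) $ j)"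
        by (rule pdeg_mono[OF poly_grad_pdeg[OF X1]]) simp
      show "pdeg UNIV d (\<lambda>w. \<Sum>i\<in>I - {i0}. M w i * poly_grad d u i (X w) $ j)"
      proof (rule pdeg_sum)
        fix i
        have "pdeg UNIV (Suc 0 + (d - 1)) (\<lambda>w. M w i * poly_grad d u i (X w) $ j)"
          unfolding M_def by (intro pdeg_mult pdeg_coord poly_grad_pdeg X1 UNIV_I)
        then show "pdeg UNIV d (\<lambda>w. M w i * poly_grad d u i (X w) $ j)" using d by simp
      qed
    qed
    then show ?thesis by (simp add: Inl L_def D_def)
  next
    case (Inr l)
    have "pdeg UNIV d (\<lambda>w. poly_fun d u i0 (X w) - poly_fun d u (\<tau> l) (X w))"
      by (intro pdeg_diff poly_fun_pdeg X1)
    then show ?thesis by (simp add: Inr L_def D_def pdeg.const)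
  qed
  have Fz: "F z $ Inl j = kkt_residual d u I i0 (X (vec_nth z)) (M (vec_nth z)) $ j"
    "i \<in> A \<Longrightarrow> F z $ Inr (\<sigma> i) = poly_fun d u i0 (X (vec_nth z)) - poly_fun d u i (X (vec_nth z))"
    "l \<notin> \<sigma> ` A \<Longrightarrow> F z $ Inr l = z $ Inr l" for z i j l
    by (simp_all add: F_def L_def c_def D_def \<tau>)
  have kkt: "kkt_point d u I i0 (X (vec_nth z)) (M (vec_nth z))" if z: "F z = 0" for z
  proof -
    have "kkt_residual d u I i0 (X (vec_nth z)) (M (vec_nth z)) = 0"
      using Fz(1)[of z] z by (simp add: vec_eq_iff)
    moreover have "poly_fun d u i (X (vec_nth z)) = poly_fun d u i0 (X (vec_nth z))" if "i \<in> I" for i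
      using Fz(2)[of i z] z that by (cases "i = i0") (auto simp: A_def)
    ultimately show ?thesis by (simp add: kkt_point_def)
  qed
  have nondeg: "v = 0" if z: "F z = 0"
    and der: "\<And>k. ((\<lambda>t. F (z + t *\<^sub>R v) $ k) has_real_derivative 0) (at 0)" for z v
  proof -
    have X_line: "X (vec_nth (z + t *\<^sub>R v)) = X (vec_nth z) + t *\<^sub>R X (vec_nth v)" for t
      by (simp add: X_def vec_eq_iff)
    have M_line: "M (vec_nth (z + t *\<^sub>R v)) = (\<lambda>i. M (vec_nth z) i + t * M (vec_nth v) i)" for t
      by (simp add: M_def)
    have "kkt_tangent d u I i0 (X (vec_nth z)) (M (vec_nth z)) (X (vec_nth v)) (M (vec_nth v))"
      unfolding kkt_tangent_def
    proof (intro conjI ballI allI)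
      fix j
      show "((\<lambda>t. kkt_residual d u I i0 (X (vec_nth z) + t *\<^sub>R X (vec_nth v))
          (\<lambda>i. M (vec_nth z) i + t * M (vec_nth v) i) $ j) has_real_derivative 0) (at 0)"
        using der[of "Inl j"] unfolding Fz X_line M_line .
    next
      fix i assume "i \<in> I"
      show "((\<lambda>t. poly_fun d u i0 (X (vec_nth z) + t *\<^sub>R X (vec_nth v))
          - poly_fun d u i (X (vec_nth z) + t *\<^sub>R X (vec_nth v))) has_real_derivative 0) (at 0)"
      proof (cases "i = i0")
        case False
        then have "i \<in> A" using \<open>i \<in> I\<close> by (simp add: A_def)
        from der[of "Inr (\<sigma> i)"] show ?thesis unfolding Fz(2)[OF \<open>i \<in> A\<close>] X_line .
      qed simp
    qed
    from reg[OF kkt[OF z] this] have 0: "X (vec_nth v) = 0" "\<And>i. i \<in> A \<Longrightarrow> M (vec_nth v) i = 0"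
      by (auto simp: A_def)
    have "v $ k = 0" for k
    proof (cases k)
      case (Inl j)
      then show ?thesis using 0(1) by (simp add: X_def vec_eq_iff)
    next
      case (Inr l)
      show ?thesis
      proof (cases "l \<in> \<sigma> ` A")
        case True
        then show ?thesis using 0(2) Inr by (auto simp: M_def)
      next
        case False
        have "((\<lambda>t. z $ Inr l + t * v $ Inr l) has_real_derivative v $ Inr l) (at 0)"
          by (auto intro!: derivative_eq_intros)
        moreover have "((\<lambda>t. z $ Inr l + t * v $ Inr l) has_real_derivative 0) (at 0)"
          using der[of "Inr l"] unfolding Fz(3)[OF False] by simp
        ultimately show ?thesis unfolding Inr by (rule DERIV_unique)
      qed
    qed
    then show ?thesis by (simp add: vec_eq_iff)
  qed
  have Z: "finite {z. F z = 0} \<and> card {z. F z = 0} \<le> (\<Prod>k\<in>UNIV. D k)"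
  proof (rule nondegenerate_zeros[OF _ degL])
    show "1 \<le> D k" for k by (simp add: D_def split: sum.split)
    show "0 \<le> c k" for k by (simp add: c_def split: sum.split)
    show "F z $ k = c k * (z $ k) ^ D k + L k (vec_nth z)" for z k by (simp add: F_def)
  qed (rule nondeg)
  \<comment> \<open>Every solution lifts to a zero of \<open>F\<close> whose surplus coordinates are
    0, so projecting the zeros to \<open>x\<close> reaches all points.\<close>
  have sub: "{x. \<exists>\<mu>. kkt_point d u I i0 x \<mu>} \<subseteq> (\<lambda>z. X (vec_nth z)) ` {z. F z = 0}"
  proof clarify
    fix x \<mu> assume k: "kkt_point d u I i0 x \<mu>"
    define z :: "real^('n + 'n)" where
      "z = (\<chi> k. case k of Inl j \<Rightarrow> x $ j | Inr l \<Rightarrow> if l \<in> \<sigma> ` A then \<mu> (\<tau> l) else 0)"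
    have Xz: "X (vec_nth z) = x" by (simp add: X_def z_def vec_eq_iff)
    have Mz: "M (vec_nth z) i = \<mu> i" if "i \<in> A" for i using that by (simp add: M_def z_def \<tau>)
    have "kkt_residual d u I i0 x (M (vec_nth z)) = kkt_residual d u I i0 x \<mu>"
      unfolding kkt_residual_def A_def[symmetric] by (simp add: Mz)
    then have "F z $ Inl j = 0" for j using k by (simp add: Fz Xz kkt_point_def)
    moreover have "F z $ Inr l = 0" for l
    proof (cases "l \<in> \<sigma> ` A")
      case True
      then obtain i where "i \<in> A" "l = \<sigma> i" by blast
      then show ?thesis using k by (simp add: Fz(2) Xz kkt_point_def A_def)
    qed (simp add: Fz(3) z_def)
    ultimately have "F z $ k = 0" for k by (cases k) auto
    then have "F z = 0" by (simp add: vec_eq_iff)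
    then show "x \<in> (\<lambda>z. X (vec_nth z)) ` {z. F z = 0}" using Xz by blast
  qed
  have "(\<Prod>k\<in>UNIV. D k) = (\<Prod>j\<in>UNIV. D (Inl j)) * (\<Prod>l\<in>UNIV. D (Inr l))"
    using prod.Plus[of "UNIV :: 'n set" "UNIV :: 'n set" D] by simp
  also have "(\<Prod>l\<in>UNIV. D (Inr l)) = (d + 1) ^ card A"
  proof -
    have "(\<Prod>l\<in>UNIV. D (Inr l)) = (\<Prod>l\<in>\<sigma> ` A. d + 1)"
      by (intro prod.mono_neutral_cong_right) (auto simp: D_def)
    then show ?thesis by (simp add: card_image[OF \<sigma>])
  qed
  also have "(\<Prod>j\<in>UNIV. D (Inl j)) = (d + 1) ^ CARD('n)" by (simp add: D_def)
  also have "(d + 1) ^ CARD('n) * (d + 1) ^ card A = (d + 1) ^ (CARD('n) - 1 + card I)"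
  proof -
    have "CARD('n) - 1 + card I = CARD('n) + card A" by (simp add: cardI)
    then show ?thesis by (simp only: power_add)
  qed
  finally have prodD: "(\<Prod>k\<in>UNIV. D k) = (d + 1) ^ (CARD('n) - 1 + card I)" .
  have "card {x. \<exists>\<mu>. kkt_point d u I i0 x \<mu>} \<le> card ((\<lambda>z. X (vec_nth z)) ` {z. F z = 0})"
    using Z sub by (intro card_mono finite_imageI) auto
  also have "\<dots> \<le> card {z. F z = 0}" using Z by (intro card_image_le) auto
  finally show ?thesis using Z sub prodD finite_subset[OF sub] by simp
qed

section \<open>Generic parameters\<close>

lemma continuous_map_poly_funs:
  "p \<in> poly_funs J \<Longrightarrow> continuous_map (powertop_real J) euclideanreal p"
proof (induction rule: poly_funs.induct)
  case (coord j)
  then show ?case using continuous_map_product_projection[of j J "\<lambda>_. euclideanreal"] by simp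
qed (simp_all add: continuous_map_add continuous_map_real_mult)

text \<open>On the line from \<open>u\<close> to \<open>w\<close>, \<open>P\<close> is a nonzero
  univariate polynomial; its finitely many roots leave points with nonzero value arbitrarily close
  to \<open>u\<close>.\<close>

lemma dense_nonzero_set:
  assumes P: "P \<in> poly_funs J" and w: "P w \<noteq> 0"
  shows "powertop_real J closure_of {u \<in> J \<rightarrow>\<^sub>E UNIV. P u \<noteq> 0} = topspace (powertop_real J)"
proof
  show "topspace (powertop_real J) \<subseteq> powertop_real J closure_of {u \<in> J \<rightarrow>\<^sub>E UNIV. P u \<noteq> 0}"
  proof
    fix u assume u: "u \<in> topspace (powertop_real J)"
    then have uE: "u \<in> extensional J" by (simp add: PiE_def)
    \<comment> \<open>Restriction to \<open>J\<close> keeps the line in the carrier of the product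
      space; \<open>P\<close> reads only coordinates in \<open>J\<close>, so its values do not
      change.\<close>
    define \<gamma> where "\<gamma> = (\<lambda>t. \<lambda>j\<in>J. u j + t * (w j - u j))"
    have \<gamma>: "continuous_map euclideanreal (powertop_real J) \<gamma>"
      unfolding continuous_map_componentwise \<gamma>_def
      by (auto intro!: continuous_intros)
    obtain q where q: "\<And>t. P (\<lambda>j. u j + t * (w j - u j)) = poly q t"
      using poly_funs_line[OF P, of u "\<lambda>j. w j - u j"] by blast
    have q\<gamma>: "P (\<gamma> t) = poly q t" for t
      unfolding q[symmetric] by (rule poly_funs_cong[OF P]) (simp add: \<gamma>_def)
    have "poly q 1 \<noteq> 0" using q[of 1] w by simp
    then have "q \<noteq> 0" by auto
    then have fin: "finite {t. poly q t = 0}" by (rule poly_roots_finite)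
    have "\<exists>y. y \<in> {u \<in> J \<rightarrow>\<^sub>E UNIV. P u \<noteq> 0} \<and> y \<in> T" if T: "u \<in> T" "openin (powertop_real J) T" for T
    proof -
      have "open {t. \<gamma> t \<in> T}" using openin_continuous_map_preimage[OF \<gamma> T(2)] by simp
      moreover have "\<gamma> 0 = u" using uE by (simp add: \<gamma>_def extensional_restrict)
      ultimately obtain e where e: "0 < e" "ball 0 e \<subseteq> {t. \<gamma> t \<in> T}"
        using T(1) open_contains_ball[of "{t. \<gamma> t \<in> T}"] by auto
      have "infinite {0<..<e}" using e(1) by (simp add: infinite_Ioo)
      then obtain t where t: "t \<in> {0<..<e}" "poly q t \<noteq> 0"
        using finite_subset[OF _ fin] by blast
      then have "t \<in> ball 0 e" by simp
      then have "\<gamma> t \<in> T" using e(2) by blast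
      moreover have "\<gamma> t \<in> J \<rightarrow>\<^sub>E UNIV" by (simp add: \<gamma>_def)
      ultimately show ?thesis using t(2) q\<gamma> by auto
    qed
    then show "u \<in> powertop_real J closure_of {u \<in> J \<rightarrow>\<^sub>E UNIV. P u \<noteq> 0}"
      using u by (simp add: in_closure_of)
  qed
qed (rule closure_of_subset_topspace)

lemma sum_matrix_vector_mult:
  "(\<Sum>i\<in>A. c i *\<^sub>R (B i :: real^'n^'m)) *v y = (\<Sum>i\<in>A. c i *\<^sub>R (B i *v y))"
  by (induction A rule: infinite_finite_induct)
    (simp_all add: matrix_vector_mult_add_rdistrib scaleR_matrix_vector_assoc)

definition regular_kkt ::
  "nat \<Rightarrow> (nat \<times> ('n::finite \<Rightarrow> nat) \<Rightarrow> real) \<Rightarrow> nat set \<Rightarrow> nat \<Rightarrow> bool" where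
  "regular_kkt d u I i0 \<longleftrightarrow> (\<forall>x \<mu>. kkt_point d u I i0 x \<mu> \<longrightarrow>
     (\<forall>i\<in>I - {i0}. \<mu> i \<noteq> 0) \<and>
     (\<forall>y \<nu>. kkt_tangent d u I i0 x \<mu> y \<nu> \<longrightarrow> y = 0 \<and> (\<forall>i\<in>I - {i0}. \<nu> i = 0)))"

lemma regular_kktD:
  assumes "regular_kkt d u I i0" "kkt_point d u I i0 x \<mu>"
  shows "\<And>i. i \<in> I - {i0} \<Longrightarrow> \<mu> i \<noteq> 0"
    and "\<And>y \<nu>. kkt_tangent d u I i0 x \<mu> y \<nu> \<Longrightarrow> y = 0 \<and> (\<forall>i\<in>I - {i0}. \<nu> i = 0)"
  using assms by (simp_all add: regular_kkt_def)

text \<open>Quantifying over all index sets makes the condition independent of the selection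
  \<open>f\<close> and its active sets.\<close>

definition regular_param ::
  "nat \<Rightarrow> nat \<Rightarrow> (nat \<times> ('n::finite \<Rightarrow> nat) \<Rightarrow> real) \<Rightarrow> bool" where
  "regular_param d r u \<longleftrightarrow> (\<forall>I i0. I \<subseteq> {1..r} \<longrightarrow> i0 \<in> I \<longrightarrow> regular_kkt d u I i0)"

text \<open>There are only finitely many pairs (I, i0), so the product of their polynomials serves
  for all of them.\<close>

lemma regular_param_generic:
  assumes "1 \<le> d"
  shows "\<exists>P\<in>poly_funs (param_indices d r :: (nat \<times> ('n::finite \<Rightarrow> nat)) set). (\<exists>u. P u \<noteq> 0) \<and>
    (\<forall>u. P u \<noteq> 0 \<longrightarrow> regular_param d r u)"
proof -
  let ?J = "param_indices d r :: (nat \<times> ('n \<Rightarrow> nat)) set"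
  define S where "S = (SIGMA I:Pow {1..r}. I)"
  have "\<exists>P\<in>poly_funs ?J. (\<exists>u. P u \<noteq> 0) \<and> (\<forall>u. P u \<noteq> 0 \<longrightarrow> regular_kkt d u (fst s) (snd s))" if "s \<in> S" for s
    using generic_kkt_points[OF assms, of "fst s" r "snd s", where 'n = 'n] that
    unfolding S_def regular_kkt_def by force
  then have "\<forall>s\<in>S. \<exists>P. P \<in> poly_funs ?J \<and> (\<exists>u. P u \<noteq> 0) \<and> (\<forall>u. P u \<noteq> 0 \<longrightarrow> regular_kkt d u (fst s) (snd s))"
    by blast
  from bchoice[OF this] obtain P where P: "\<And>s. s \<in> S \<Longrightarrow> P s \<in> poly_funs ?J"
    "\<And>s. s \<in> S \<Longrightarrow> \<exists>u. P s u \<noteq> 0" "\<And>s u. s \<in> S \<Longrightarrow> P s u \<noteq> 0 \<Longrightarrow> regular_kkt d u (fst s) (snd s)" by blast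
  have fin: "finite S" unfolding S_def by (intro finite_SigmaI) (auto intro: finite_subset)
  have poly: "(\<lambda>u. \<Prod>s\<in>S. P s u) \<in> poly_funs ?J" by (rule poly_funs_prod) (erule P)
  have nz: "\<exists>u. (\<Prod>s\<in>S. P s u) \<noteq> 0"
    by (rule poly_funs_prod_nonzero[OF fin, where p = P and J = ?J]) (erule P)+
  have reg: "regular_param d r u" if "(\<Prod>s\<in>S. P s u) \<noteq> 0" for u
  proof -
    have "P s u \<noteq> 0" if "s \<in> S" for s using \<open>(\<Prod>s\<in>S. P s u) \<noteq> 0\<close> fin that by auto
    then have "regular_kkt d u I i0" if "I \<subseteq> {1..r}" "i0 \<in> I" for I i0
      using P(3)[of "(I, i0)" u] that by (simp add: S_def)
    then show ?thesis by (simp add: regular_param_def)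
  qed
  show ?thesis
    by (rule bexI[OF _ poly]) (intro conjI nz allI impI reg)
qed

text \<open>Expanding the product of \<open>x + 1\<close> over \<open>A\<close> produces one term
  for each subset.\<close>

lemma sum_power_card_subsets:
  "finite A \<Longrightarrow> (\<Sum>I\<in>Pow A. (x :: nat) ^ card I) = (x + 1) ^ card A"
  using prod_add[of A "\<lambda>_. x" "\<lambda>_. 1"] by simp

section \<open>From multiplier tuples to regular solutions\<close>

lemma multiplier_kkt_point:
  assumes \<mu>: "multiplier d r u f x \<mu>" and i0: "i0 \<in> active d r u f x" "0 < \<mu> i0"
  shows "kkt_point d u (active d r u f x) i0 x (\<lambda>i. \<mu> i / \<mu> i0)"
proof -
  let ?A = "active d r u f x"
  have fin: "finite ?A" by (simp add: active_def)
  have "0 = (1 / \<mu> i0) *\<^sub>R (\<Sum>i\<in>?A. \<mu> i *\<^sub>R poly_grad d u i x)"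
    using \<mu> by (simp add: multiplier_def gradient_poly_fun)
  also have "\<dots> = (\<Sum>i\<in>?A. (\<mu> i / \<mu> i0) *\<^sub>R poly_grad d u i x)" by (simp add: scaleR_sum_right)
  also have "\<dots> = kkt_residual d u ?A i0 x (\<lambda>i. \<mu> i / \<mu> i0)"
    using i0 fin by (simp add: kkt_residual_def sum.remove)
  finally show ?thesis using i0 by (auto simp: kkt_point_def active_def)
qed

lemma multiplier_pos_index:
  assumes "multiplier d r u f x \<mu>"
  shows "\<exists>i\<in>active d r u f x. 0 < \<mu> i"
proof (rule ccontr)
  assume "\<not> ?thesis"
  then have "(\<Sum>i\<in>active d r u f x. \<mu> i) \<le> 0" by (intro sum_nonpos) auto
  then show False using assms by (simp add: multiplier_def)
qed

lemma active_subset: "active d r u f x \<subseteq> {1..r}"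
  by (auto simp: active_def)

lemma regular_active:
  "regular_param d r u \<Longrightarrow> i0 \<in> active d r u f x \<Longrightarrow> regular_kkt d u (active d r u f x) i0"
  using active_subset[of d r u f x] by (simp add: regular_param_def)

text \<open>Some multiplier is positive because the sum is 1. After division by it regularity makes
  the others nonzero, hence positive by their sign condition.\<close>

lemma regular_strict_complementarity:
  assumes "regular_param d r u"
  shows "strict_complementarity d r u f x"
  unfolding strict_complementarity_def
proof (intro allI impI ballI)
  fix \<mu> i assume \<mu>: "multiplier d r u f x \<mu>" and i: "i \<in> active d r u f x"
  obtain i0 where i0: "i0 \<in> active d r u f x" "0 < \<mu> i0" using multiplier_pos_index[OF \<mu>] by blast
  have "\<forall>i\<in>active d r u f x - {i0}. \<mu> i / \<mu> i0 \<noteq> 0"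
    using regular_kktD(1)[OF regular_active[OF assms i0(1)] multiplier_kkt_point[OF \<mu> i0]] by blast
  then have "\<mu> i \<noteq> 0" using i i0(2) by (cases "i = i0") auto
  moreover have "0 \<le> \<mu> i" using \<mu> i by (simp add: multiplier_def)
  ultimately show "0 < \<mu> i" by simp
qed

text \<open>The pair (y, 0) is a kernel direction for the active set: the value equations are
  stationary because all active gradients annihilate \<open>y\<close>, and the derivative of the
  residual is the weighted Hessian applied to \<open>y\<close>, divided by \<open>\<mu> i0\<close>.
  Regularity then forces \<open>y = 0\<close>.\<close>

lemma regular_second_order:
  assumes reg: "regular_param d r u" and \<mu>: "multiplier d r u f x \<mu>"
    and grad: "\<And>i. i \<in> active d r u f x \<Longrightarrow> gradient (poly_fun d u i) x \<bullet> y = 0"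
    and hess: "(\<Sum>i \<in> active d r u f x. \<mu> i *\<^sub>R hessian (poly_fun d u i) x) *v y = 0"
  shows "y = 0"
proof -
  let ?A = "active d r u f x"
  have fin: "finite ?A" by (simp add: active_def)
  obtain i0 where i0: "i0 \<in> ?A" "0 < \<mu> i0" using multiplier_pos_index[OF \<mu>] by blast
  have "kkt_tangent d u ?A i0 x (\<lambda>i. \<mu> i / \<mu> i0) y (\<lambda>_. 0)"
    unfolding kkt_tangent_def
  proof (intro conjI ballI allI)
    fix i assume "i \<in> ?A"
    then have "poly_grad d u i0 x \<bullet> y - poly_grad d u i x \<bullet> y = 0"
      using grad i0(1) by (simp add: gradient_poly_fun)
    then show "((\<lambda>t. poly_fun d u i0 (x + t *\<^sub>R y) - poly_fun d u i (x + t *\<^sub>R y)) has_real_derivative 0) (at 0)"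
      using DERIV_diff[OF poly_fun_deriv_line[of d u i0 x y] poly_fun_deriv_line[of d u i x y]] by simp
  next
    fix j
    let ?h = "\<lambda>i. (hessian (poly_fun d u i) x *v y) $ j"
    have "((\<lambda>t. poly_grad d u i0 (x + t *\<^sub>R y) $ j
        + (\<Sum>i\<in>?A - {i0}. \<mu> i / \<mu> i0 * poly_grad d u i (x + t *\<^sub>R y) $ j))
        has_real_derivative ?h i0 + (\<Sum>i\<in>?A - {i0}. \<mu> i / \<mu> i0 * ?h i)) (at 0)"
      by (intro DERIV_add DERIV_sum DERIV_cmult poly_grad_deriv_line)
    moreover have "?h i0 + (\<Sum>i\<in>?A - {i0}. \<mu> i / \<mu> i0 * ?h i) = 0"
    proof -
      have "0 = ((\<Sum>i\<in>?A. \<mu> i *\<^sub>R hessian (poly_fun d u i) x) *v y) $ j / \<mu> i0" by (simp add: hess)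
      also have "\<dots> = (\<Sum>i\<in>?A. \<mu> i / \<mu> i0 * ?h i)"
        by (simp add: sum_matrix_vector_mult sum_divide_distrib)
      also have "\<dots> = ?h i0 + (\<Sum>i\<in>?A - {i0}. \<mu> i / \<mu> i0 * ?h i)"
        using i0 fin by (simp add: sum.remove)
      finally show ?thesis by simp
    qed
    ultimately show "((\<lambda>t. kkt_residual d u ?A i0 (x + t *\<^sub>R y) (\<lambda>i. \<mu> i / \<mu> i0 + t * 0) $ j)
        has_real_derivative 0) (at 0)"
      by (simp add: kkt_residual_def)
  qed
  then show ?thesis
    using regular_kktD(2)[OF regular_active[OF reg i0(1)] multiplier_kkt_point[OF \<mu> i0]] by blast
qed

lemma critical_multiplier:
  assumes "f \<in> cont_selections d r u" "critical_point f x"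
  shows "\<exists>\<mu>. multiplier d r u f x \<mu>"
proof -
  have cont: "continuous_on UNIV (poly_grad d u i)" for i
    by (intro continuous_at_imp_continuous_on ballI differentiable_imp_continuous_within
        poly_grad_differentiable)
  have f: "continuous_on UNIV f" "\<And>y. f y \<in> (\<lambda>i. poly_fun d u i y) ` {1..r}"
    using assms(1) by (simp_all add: cont_selections_def)
  have "\<exists>\<mu>. (\<forall>i\<in>active d r u f x. 0 \<le> \<mu> i) \<and> (\<Sum>i\<in>active d r u f x. \<mu> i) = 1 \<and>
      (\<Sum>i\<in>active d r u f x. \<mu> i *\<^sub>R poly_grad d u i x) = 0"
    by (rule critical_selection_multiplier[where g = "poly_fun d u" and G = "poly_grad d u" and f = f,
          OF finite_atLeastAtMost poly_fun_GDERIV cont f assms(2)]) (rule active_def)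
  then show ?thesis by (simp add: multiplier_def gradient_poly_fun)
qed

text \<open>Every critical point solves the system of its active set. Strict complementarity makes
  the multiplier at \<open>Min I\<close> positive, so this one normalisation per index set suffices
  and each set is counted once.\<close>

lemma regular_Crit_bound:
  fixes u :: "nat \<times> ('n::finite \<Rightarrow> nat) \<Rightarrow> real"
  assumes d: "1 \<le> d" and r: "1 \<le> r" and reg: "regular_param d r u"
  shows "finite (Crit d r u) \<and> card (Crit d r u) \<le> B\<^sub>0 CARD('n) d r"
proof -
  define S where "S = Pow {1..r} - {{}}"
  define Z where "Z = (\<lambda>I. {x. \<exists>\<mu>. kkt_point d u I (Min I) x \<mu>})"
  have finS: "finite S" by (simp add: S_def)
  have Z: "finite (Z I) \<and> card (Z I) \<le> (d + 1) ^ (CARD('n) - 1 + card I)" if "I \<in> S" for I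
  proof -
    have I: "I \<subseteq> {1..r}" "finite I" "I \<noteq> {}" using that by (auto simp: S_def intro: finite_subset)
    then have "Min I \<in> I" by simp
    then have "regular_kkt d u I (Min I)" using reg I(1) by (simp add: regular_param_def)
    from card_kkt_points[OF d I(2) \<open>Min I \<in> I\<close> regular_kktD(2)[OF this]]
    show ?thesis unfolding Z_def .
  qed
  have sub: "Crit d r u \<subseteq> (\<Union>I\<in>S. Z I)"
  proof
    fix x assume "x \<in> Crit d r u"
    then obtain f where f: "f \<in> cont_selections d r u" "critical_point f x" by (auto simp: Crit_def)
    obtain \<mu> where \<mu>: "multiplier d r u f x \<mu>" using critical_multiplier[OF f] by blast
    let ?A = "active d r u f x"
    have A: "?A \<noteq> {}" "finite ?A" using multiplier_pos_index[OF \<mu>] by (auto simp: active_def)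
    then have "Min ?A \<in> ?A" by simp
    moreover have "0 < \<mu> (Min ?A)"
      using regular_strict_complementarity[OF reg, of f x] \<mu> \<open>Min ?A \<in> ?A\<close>
      unfolding strict_complementarity_def by blast
    ultimately have "x \<in> Z ?A" unfolding Z_def using multiplier_kkt_point[OF \<mu>] by blast
    moreover have "?A \<in> S" using A(1) active_subset[of d r u f x] unfolding S_def by blast
    ultimately show "x \<in> (\<Union>I\<in>S. Z I)" by blast
  qed
  have fin: "finite (\<Union>I\<in>S. Z I)" using finS Z by blast
  let ?m = "CARD('n) - 1"
  have "card (Crit d r u) \<le> card (\<Union>I\<in>S. Z I)" using sub fin by (rule card_mono[rotated])
  also have "\<dots> \<le> (\<Sum>I\<in>S. card (Z I))" by (rule card_UN_le[OF finS])
  also have "\<dots> \<le> (\<Sum>I\<in>S. (d + 1) ^ (?m + card I))" using Z by (intro sum_mono) blast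
  \<comment> \<open>The empty set adds a nonnegative term and completes the sum to one over all
    subsets.\<close>
  also have "\<dots> \<le> (\<Sum>I\<in>Pow {1..r}. (d + 1) ^ (?m + card I))"
    by (rule sum_mono2) (auto simp: S_def)
  also have "\<dots> = (d + 1) ^ ?m * (d + 2) ^ r"
    using sum_power_card_subsets[of "{1..r}" "d + 1"]
    unfolding power_add sum_distrib_left[symmetric] by simp
  \<comment> \<open>Here \<open>d + 2 \<le> 2 * d + 1\<close> holds because
    \<open>1 \<le> d\<close>; the result is dominated by the first term of
    \<open>B\<^sub>0\<close>.\<close>
  also have "\<dots> \<le> (2 * d + 1) ^ ?m * (2 * d + 1) ^ r"
    using d by (intro mult_mono power_mono) auto
  also have "\<dots> = (2 * d + 1) ^ (CARD('n) + r - 1)"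
  proof -
    have "0 < CARD('n)" by simp
    then have "CARD('n) + r - 1 = ?m + r" by linarith
    then show ?thesis by (simp only: power_add)
  qed
  also have "\<dots> \<le> B\<^sub>0 CARD('n) d r" by (simp add: B\<^sub>0_def)
  finally show ?thesis using finite_subset[OF sub fin] by simp
qed

theorem theorem4p1:
  fixes d r :: nat
  assumes "d \<ge> 1" and "r \<ge> 1"
  shows "\<exists>U :: (nat \<times> ('n::finite \<Rightarrow> nat) \<Rightarrow> real) set.
    openin (powertop_real (param_indices d r)) U \<and>
    powertop_real (param_indices d r) closure_of U = topspace (powertop_real (param_indices d r)) \<and>
    U \<in> semialgebraic (param_indices d r) \<and>
    (\<forall>u \<in> U.
       finite (Crit d r u) \<and> card (Crit d r u) \<le> B\<^sub>0 CARD('n) d r \<and>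
       (\<forall>f \<in> cont_selections d r u. \<forall>x0. critical_point f x0 \<longrightarrow>
          strict_complementarity d r u f x0 \<and>
          (\<forall>\<mu>. multiplier d r u f x0 \<mu> \<longrightarrow>
             \<not> (\<exists>y. y \<noteq> 0 \<and>
                  (\<forall>i \<in> active d r u f x0. gradient (poly_fun d u i) x0 \<bullet> y = 0) \<and>
                  (\<Sum>i \<in> active d r u f x0. \<mu> i *\<^sub>R hessian (poly_fun d u i) x0) *v y = 0))))"
proof -
  let ?J = "param_indices d r :: (nat \<times> ('n \<Rightarrow> nat)) set"
  obtain P where P: "P \<in> poly_funs ?J" "\<exists>u. P u \<noteq> 0" "\<And>u. P u \<noteq> 0 \<Longrightarrow> regular_param d r u"
    using regular_param_generic[OF assms(1), of r, where 'n = 'n] by blast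
  define U where "U = {u \<in> ?J \<rightarrow>\<^sub>E UNIV. P u \<noteq> 0}"
  have U_open: "openin (powertop_real ?J) U"
    using openin_continuous_map_preimage[OF continuous_map_poly_funs[OF P(1)], of "- {0}"]
    by (simp add: U_def open_Compl)
  have U_dense: "powertop_real ?J closure_of U = topspace (powertop_real ?J)"
    unfolding U_def using P(2) dense_nonzero_set[OF P(1)] by blast
  have U_semialgebraic: "U \<in> semialgebraic ?J"
  proof -
    \<comment> \<open>Squaring turns \<open>P u \<noteq> 0\<close> into a single strict inequality,
      the generating form of semialgebraic sets.\<close>
    have "U = {u \<in> ?J \<rightarrow>\<^sub>E UNIV. P u * P u > 0}" by (auto simp: U_def zero_less_mult_iff)
    then show ?thesis using semialgebraic.pos[OF poly_funs.mult[OF P(1) P(1)]] by simp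
  qed
  have U_regular: "finite (Crit d r u) \<and> card (Crit d r u) \<le> B\<^sub>0 CARD('n) d r \<and>
       (\<forall>f \<in> cont_selections d r u. \<forall>x0. critical_point f x0 \<longrightarrow>
          strict_complementarity d r u f x0 \<and>
          (\<forall>\<mu>. multiplier d r u f x0 \<mu> \<longrightarrow>
             \<not> (\<exists>y. y \<noteq> 0 \<and>
                  (\<forall>i \<in> active d r u f x0. gradient (poly_fun d u i) x0 \<bullet> y = 0) \<and>
                  (\<Sum>i \<in> active d r u f x0. \<mu> i *\<^sub>R hessian (poly_fun d u i) x0) *v y = 0)))"
    if "u \<in> U" for u
  proof -
    have reg: "regular_param d r u" using that P(3) by (simp add: U_def)
    show ?thesis
      using regular_Crit_bound[OF assms reg] regular_strict_complementarity[OF reg]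
        regular_second_order[OF reg] by blast
  qed
  show ?thesis
    by (rule exI[of _ U], rule conjI[OF U_open conjI[OF U_dense conjI[OF U_semialgebraic ballI[OF U_regular]]]])
qed

end
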